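(* Suppose $p$ is a prime, and let $E(p)$ be the number of equivalence classes of cubic MRS functions in $p$ variables. Then $$E(p)=[p/6]+1,$$ where $[\cdot]$ denotes the integer part. Suppose $p>5$. There is exactly one equivalence class of size $(p-1)/2$, namely the class containing $(1,2,3)$. If $p\equiv 1\pmod 6$, there is exactly one equivalence class of size $(p-1)/3$. If $p\equiv 1\pmod 6$, all the remaining $E(p)-2$ equivalence classes have size $p-1$. If $p\equiv 5\pmod 6$, all the remaining $E(p)-1$ equivalence classes have size $p-1$.
   Context: A Boolean function in $n$ variables is written in algebraic normal form as a polynomial over $GF(2)$ in $x_1,\dots,x_n$; indices are read modulo $n$ in $\{1,\dots,n\}$. A function is rotation symmetric if its algebraic normal form is unchanged by every cyclic shift of the variables. For pairwise distinct $1,j,k\in\{1,\dots,n\}$, the cubic monomial rotation symmetric (MRS) function $(1,j,k)$ is the sum of the distinct monomials among $x_{1+t}x_{j+t}x_{k+t}$, $t=0,\dots,n-1$. A permutation $\sigma$ of $\{1,\dots,n\}$ acts on functions by replacing each $x_i$ by $x_{\sigma(i)}$. It preserves rotation symmetry if $\sigma(f)$ is rotation symmetric for every cubic MRS function $f$ in $n$ variables. Two cubic MRS functions $f,g$ in $n$ variables are equivalent if $\sigma(f)=g$ for some permutation $\sigma$ which preserves rotation symmetry; the size of an equivalence class is the number of distinct functions in it.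
   Formalization: The prime p = 2 is excluded (p ≥ 3 is assumed): with only two variables there are no pairwise distinct 1, j, k, hence no cubic MRS functions, so E(2) = 0 while [2/6]+1 = 1. *)

theory Defs
  imports
    "HOL-Library.Poly_Mapping"
    "HOL-Library.Z2"
    "HOL-Combinatorics.Permutations"
    "HOL-Computational_Algebra.Primes"
begin

text \<open>
  A Boolean function is identified with its algebraic normal form, a polynomial over
  \<open>GF(2)\<close> (type \<^typ>\<open>bit\<close>) in variables indexed by natural numbers. All polynomials
  occurring below are multilinear, and permuting the variables keeps them so; hence the
  relations \<open>x\<^sub>i\<^sup>2 = x\<^sub>i\<close> never have to be applied.
\<close>

type_synonym anf = "(nat \<Rightarrow>\<^sub>0 nat) \<Rightarrow>\<^sub>0 bit"

definition var :: "nat \<Rightarrow> anf" where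
  "var i = Poly_Mapping.single (Poly_Mapping.single i 1) 1"

text \<open>The action of \<open>\<sigma>\<close> on polynomials: every \<open>x\<^sub>i\<close> is replaced by \<open>x\<^bsub>\<sigma> i\<^esub>\<close>.\<close>

definition rename_vars :: "(nat \<Rightarrow> nat) \<Rightarrow> anf \<Rightarrow> anf" where
  "rename_vars \<sigma> f =
     (\<Sum>m\<in>Poly_Mapping.keys f.
        Poly_Mapping.single 0 (Poly_Mapping.lookup f m) *
        (\<Prod>i\<in>Poly_Mapping.keys m. var (\<sigma> i) ^ Poly_Mapping.lookup m i))"

text \<open>The representative of \<open>i\<close> modulo \<open>n\<close> in \<open>{1..n}\<close> (rather than in \<open>{0..<n}\<close>).\<close>

definition cyc :: "nat \<Rightarrow> nat \<Rightarrow> nat" where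
  "cyc n i = (if i mod n = 0 then n else i mod n)"

definition rotation_symmetric :: "nat \<Rightarrow> anf \<Rightarrow> bool" where
  "rotation_symmetric n f \<longleftrightarrow> (\<forall>t. rename_vars (\<lambda>i. cyc n (i + t)) f = f)"

text \<open>
  The sum ranges over a set of polynomials, so that a monomial arising from several
  shifts \<open>t\<close> is counted once.
\<close>

definition mrs :: "nat \<Rightarrow> nat \<Rightarrow> nat \<Rightarrow> nat \<Rightarrow> anf" where
  "mrs n i j k =
     \<Sum>((\<lambda>t. var (cyc n (i + t)) * var (cyc n (j + t)) * var (cyc n (k + t))) ` {0..<n})"

definition cubic_mrs :: "nat \<Rightarrow> anf set" where
  "cubic_mrs n = {mrs n 1 j k | j k. j \<in> {1..n} \<and> k \<in> {1..n} \<and> distinct [1, j, k]}"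

definition preserves_rotation_symmetry :: "nat \<Rightarrow> (nat \<Rightarrow> nat) \<Rightarrow> bool" where
  "preserves_rotation_symmetry n \<sigma> \<longleftrightarrow>
     \<sigma> permutes {1..n} \<and> (\<forall>f\<in>cubic_mrs n. rotation_symmetric n (rename_vars \<sigma> f))"

definition mrs_equiv :: "nat \<Rightarrow> anf rel" where
  "mrs_equiv n =
     {(f, g). f \<in> cubic_mrs n \<and> g \<in> cubic_mrs n \<and>
        (\<exists>\<sigma>. preserves_rotation_symmetry n \<sigma> \<and> rename_vars \<sigma> f = g)}"

definition mrs_classes :: "nat \<Rightarrow> anf set set" where
  "mrs_classes n = cubic_mrs n // mrs_equiv n"

definition num_classes :: "nat \<Rightarrow> nat" where
  "num_classes n = card (mrs_classes n)"

end

theory Submission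
  imports Defs "HOL-Number_Theory.Cong"
begin

text \<open>
  For a prime \<open>p > 3\<close>, a permutation \<open>\<sigma>\<close> preserving rotation symmetry conjugates the
  rotation to a permutation that maps triples of consecutive residues to such triples. It is
  therefore a translation or a reflection, and a reflection has a fixed point; hence \<open>\<sigma>\<close>
  is affine. A class is thus an affine orbit of 3-subsets of \<open>GF(p)\<close>, given by the ratio
  \<open>l = (c - a) / (b - a)\<close> in \<open>GF(p) - {0, 1}\<close> up to reordering \<open>a, b, c\<close>. If \<open>r\<close>
  ratios belong to a class, the class has \<open>(p - 1) r / 6\<close> elements. The only exceptions to
  \<open>r = 6\<close> are \<open>{-1, 2, 1/2}\<close> and the roots of \<open>l\<^sup>2 - l + 1\<close>, so counting the \<open>p - 2\<close>
  ratios modulo 6 yields everything.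
\<close>

section \<open>Boolean functions as families of vertex sets\<close>

text \<open>Let \<open>g\<close> be the rotation conjugated by \<open>\<sigma>\<close>. The
  monomials of \<open>(1, 2, 3)\<close> are the triples of consecutive residues; that its image
  under \<open>\<sigma>\<close> is fixed by the rotation says that \<open>g\<close> carries such
  triples to such triples. Neighbouring triples overlap in two points, and this rigidity leaves only
  \<open>x + c\<close> and \<open>c - x\<close>. The second fixes \<open>c / 2\<close> because 2 is
  invertible, whereas \<open>g\<close>, like the rotation, moves every point. Then
  \<open>\<sigma>\<close> turns translation by \<open>c\<close> into translation by 1, which makes
  it affine with slope \<open>1 / c\<close>. Its translation part is invisible on functions, so
  classes are orbits of scalings alone.

  The 6 in the size of a class counts the orderings of a triple; they yield six different pairs of
  differences because \<open>p > 3\<close>. Since the two roots of \<open>l * l - l + 1\<close> are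
  exchanged by \<open>l \<mapsto> 1 - l\<close>, they give at most one class. Hence
  \<open>p - 2 = 3 + 2 * b + 6 * a\<close> with \<open>b \<le> 1\<close>, and \<open>p\<close> alone
  determines \<open>a\<close> and \<open>b\<close>; even the existence of a root is read off from
  this count.\<close>

definition expo :: "nat set \<Rightarrow> nat \<Rightarrow>\<^sub>0 nat" where
  "expo T = (\<Sum>i\<in>T. Poly_Mapping.single i 1)"

text \<open>Over \<open>GF(2)\<close> a multilinear polynomial is the set of its monomials, and a
  monomial is the set of its variables. Every function below is written in this form, so that
  questions about polynomials become questions about families of sets.\<close>

definition anf_of :: "nat set set \<Rightarrow> anf" where
  "anf_of \<T> = (\<Sum>T\<in>\<T>. \<Prod>i\<in>T. var i)"

lemma lookup_expo: "finite T \<Longrightarrow> Poly_Mapping.lookup (expo T) i = (if i \<in> T then 1 else 0)"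
  by (simp add: expo_def lookup_sum lookup_single when_def)

lemma keys_expo: "finite T \<Longrightarrow> Poly_Mapping.keys (expo T) = T"
  by (auto simp: in_keys_iff lookup_expo split: if_splits)

lemma prod_var: "finite T \<Longrightarrow> (\<Prod>i\<in>T. var i) = Poly_Mapping.single (expo T) 1"
proof (induction T rule: finite_induct)
  case empty
  then show ?case by (simp add: expo_def)
next
  case (insert x T)
  then show ?case by (simp add: expo_def var_def mult_single)
qed

lemma finite_Union_member: "finite (\<Union>\<T>) \<Longrightarrow> T \<in> \<T> \<Longrightarrow> finite T"
  by (meson Union_upper finite_subset)

lemma inj_on_expo: "finite (\<Union>\<T>) \<Longrightarrow> inj_on expo \<T>"
  by (rule inj_on_inverseI[where g = Poly_Mapping.keys]) (metis finite_Union_member keys_expo)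

lemma lookup_anf_of:
  assumes "finite (\<Union>\<T>)"
  shows "Poly_Mapping.lookup (anf_of \<T>) m = (if m \<in> expo ` \<T> then 1 else 0)"
proof -
  have "Poly_Mapping.lookup (anf_of \<T>) m = (\<Sum>T\<in>\<T>. if expo T = m then 1 else 0)"
    unfolding anf_of_def lookup_sum
    by (rule sum.cong) (auto simp: prod_var finite_Union_member[OF assms] lookup_single when_def)
  also have "\<dots> = (\<Sum>m'\<in>expo ` \<T>. if m' = m then 1 else 0)"
    by (simp add: sum.reindex[OF inj_on_expo[OF assms]])
  finally show ?thesis using finite_UnionD[OF assms] by simp
qed

lemma keys_anf_of: "finite (\<Union>\<T>) \<Longrightarrow> Poly_Mapping.keys (anf_of \<T>) = expo ` \<T>"
  by (auto simp: in_keys_iff lookup_anf_of split: if_splits)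

lemma keys_keys_anf_of:
  assumes "finite (\<Union>\<T>)"
  shows "Poly_Mapping.keys ` Poly_Mapping.keys (anf_of \<T>) = \<T>"
proof -
  have "Poly_Mapping.keys ` Poly_Mapping.keys (anf_of \<T>) = (\<lambda>T. T) ` \<T>"
    unfolding keys_anf_of[OF assms] image_image
    by (intro image_cong refl keys_expo finite_Union_member[OF assms])
  then show ?thesis by simp
qed

lemma anf_of_eq_iff:
  "finite (\<Union>\<T>) \<Longrightarrow> finite (\<Union>\<U>) \<Longrightarrow> anf_of \<T> = anf_of \<U> \<longleftrightarrow> \<T> = \<U>"
  by (metis keys_keys_anf_of)

text \<open>Injectivity matters twice: variables of one monomial do not merge, and different
  monomials keep different images, so nothing cancels modulo 2.\<close>

lemma rename_vars_anf_of:
  assumes "finite V" "\<Union>\<T> \<subseteq> V" "inj_on \<sigma> V"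
  shows "rename_vars \<sigma> (anf_of \<T>) = anf_of ((`) \<sigma> ` \<T>)"
proof -
  have fin: "finite (\<Union>\<T>)"
    using assms(1,2) by (rule finite_subset[rotated])
  have inj: "inj_on ((`) \<sigma>) \<T>"
    using assms(2,3) by (meson inj_on_image inj_on_subset)
  have "rename_vars \<sigma> (anf_of \<T>) =
      (\<Sum>T\<in>\<T>. \<Prod>i\<in>Poly_Mapping.keys (expo T). var (\<sigma> i) ^ Poly_Mapping.lookup (expo T) i)"
    by (simp add: rename_vars_def keys_anf_of fin sum.reindex[OF inj_on_expo] lookup_anf_of)
  also have "\<dots> = (\<Sum>T\<in>\<T>. \<Prod>i\<in>\<sigma> ` T. var i)"
  proof (rule sum.cong)
    fix T assume T: "T \<in> \<T>"
    then have "inj_on \<sigma> T" using assms(2,3) by (meson Union_upper inj_on_subset)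
    then show "(\<Prod>i\<in>Poly_Mapping.keys (expo T). var (\<sigma> i) ^ Poly_Mapping.lookup (expo T) i) =
        (\<Prod>i\<in>\<sigma> ` T. var i)"
      using finite_Union_member[OF fin T] by (simp add: prod.reindex keys_expo lookup_expo)
  qed simp
  also have "\<dots> = anf_of ((`) \<sigma> ` \<T>)"
    by (simp add: anf_of_def sum.reindex[OF inj])
  finally show ?thesis .
qed

section \<open>Residues modulo \<open>p\<close> and translation classes of triples\<close>

text \<open>Residues are integers, so that differences and negatives are available, while labels
  live in \<open>{1..p}\<close>. The shift by 1 before and after the reduction sends the residue 0
  to \<open>p\<close>, in agreement with \<open>cyc\<close>.\<close>

definition vertex :: "nat \<Rightarrow> int \<Rightarrow> nat" where
  "vertex p x = nat ((x - 1) mod int p) + 1"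

text \<open>A translation class of triples, recorded by the differences \<open>u\<close>,
  \<open>v\<close> from a base point \<open>a\<close>. The base point runs over all integers; the
  repetitions vanish in the set.\<close>

definition triple_fun :: "nat \<Rightarrow> int \<Rightarrow> int \<Rightarrow> anf" where
  "triple_fun p u v = anf_of (range (\<lambda>a. {vertex p a, vertex p (a + u), vertex p (a + v)}))"

lemma vertex_eq_iff: "p > 0 \<Longrightarrow> vertex p x = vertex p y \<longleftrightarrow> [x = y] (mod int p)"
  by (simp add: vertex_def eq_nat_nat_iff cong_iff_dvd_diff mod_eq_dvd_iff)

lemma vertex_in: "p > 0 \<Longrightarrow> vertex p x \<in> {1..p}"
  by (simp add: vertex_def Suc_le_eq nat_less_iff)

lemma vertex_of_nat: "i \<in> {1..p} \<Longrightarrow> vertex p (int i) = i"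
  by (auto simp: vertex_def)

lemma vertex_add_cong:
  "p > 0 \<Longrightarrow> [x = y] (mod int p) \<Longrightarrow> vertex p (x + z) = vertex p (y + z)"
  by (simp add: vertex_eq_iff cong_add)

lemma triple_cong:
  assumes "p > 0" "[x = y] (mod int p)"
  shows "{vertex p x, vertex p (x + u), vertex p (x + v)} =
    {vertex p y, vertex p (y + u), vertex p (y + v)}"
  using vertex_add_cong[OF assms, of 0] vertex_add_cong[OF assms, of u]
    vertex_add_cong[OF assms, of v] by simp

lemma cyc_eq_vertex:
  assumes "p > 0"
  shows "cyc p i = vertex p (int i)"
proof -
  have "cyc p i \<in> {1..p}" using assms by (simp add: cyc_def Suc_leI less_imp_le)
  then have "cyc p i = vertex p (int (cyc p i))" by (simp add: vertex_of_nat)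
  also have "\<dots> = vertex p (int i)"
    unfolding vertex_eq_iff[OF assms] cong_int_iff by (simp add: cyc_def cong_def)
  finally show ?thesis .
qed

lemma cong_int_vertex: "p > 0 \<Longrightarrow> [int (vertex p x) = x] (mod int p)"
  using vertex_eq_iff[of p "int (vertex p x)" x] vertex_of_nat[OF vertex_in] by simp

definition nondegenerate :: "nat \<Rightarrow> int \<Rightarrow> int \<Rightarrow> bool" where
  "nondegenerate p u v \<longleftrightarrow>
     \<not> [u = 0] (mod int p) \<and> \<not> [v = 0] (mod int p) \<and> \<not> [u = v] (mod int p)"

lemma finite_Union_triples:
  "p > 0 \<Longrightarrow> finite (\<Union>a. {vertex p (f a), vertex p (g a), vertex p (h a)})"
  by (rule finite_subset[of _ "{1..p}"]) (use vertex_in in auto)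

lemma triple_fun_cong:
  assumes "p > 0" "[u = u'] (mod int p)" "[v = v'] (mod int p)"
  shows "triple_fun p u v = triple_fun p u' v'"
proof -
  have "vertex p (a + u) = vertex p (a + u')" "vertex p (a + v) = vertex p (a + v')" for a
    using assms by (auto simp: vertex_eq_iff cong_add)
  then show ?thesis by (simp add: triple_fun_def)
qed

lemma triple_fun_swap: "triple_fun p v u = triple_fun p u v"
  by (simp add: triple_fun_def insert_commute)

text \<open>The second point of each triple becomes the base point. Together with the swap this
  generates all six orderings.\<close>

lemma triple_fun_shift: "triple_fun p (- u) (v - u) = triple_fun p u v"
proof -
  let ?g = "\<lambda>a. {vertex p a, vertex p (a + u), vertex p (a + v)}"
  have "(\<lambda>a. {vertex p a, vertex p (a + - u), vertex p (a + (v - u))}) = ?g \<circ> (\<lambda>a. a - u)"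
    by (auto simp: fun_eq_iff algebra_simps)
  then have "range (\<lambda>a. {vertex p a, vertex p (a + - u), vertex p (a + (v - u))}) = range ?g"
    by (simp only: image_comp[symmetric] surj_diff_right)
  then show ?thesis by (simp add: triple_fun_def)
qed

text \<open>The triple based at \<open>a\<close> goes to the one based at \<open>m * a + c\<close>
  with differences scaled by \<open>m\<close>, and \<open>m * a + c\<close> runs through all
  residues because \<open>m\<close> is invertible.\<close>

lemma rename_triple_fun:
  assumes "p > 0" "inj_on \<sigma> {1..p}" "coprime m (int p)"
    and \<sigma>: "\<And>x. \<sigma> (vertex p x) = vertex p (m * x + c)"
  shows "rename_vars \<sigma> (triple_fun p u v) = triple_fun p (m * u) (m * v)"
proof -
  let ?g = "\<lambda>a. {vertex p a, vertex p (a + m * u), vertex p (a + m * v)}"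
  let ?h = "\<lambda>a. {vertex p a, vertex p (a + u), vertex p (a + v)}"
  have "range ?g = range (\<lambda>a. ?g (m * a + c))"
  proof (intro antisym subsetI)
    fix T assume "T \<in> range ?g"
    then obtain a where T: "T = ?g a" by blast
    obtain k where "[m * k = 1] (mod int p)"
      using assms(3) cong_solve_coprime_int by blast
    then have "[m * k * (a - c) + c = 1 * (a - c) + c] (mod int p)"
      by (intro cong_add cong_mult) auto
    then have "[m * (k * (a - c)) + c = a] (mod int p)"
      by (simp add: mult.assoc)
    then have "?g (m * (k * (a - c)) + c) = ?g a"
      by (rule triple_cong[OF assms(1)])
    then show "T \<in> range (\<lambda>a. ?g (m * a + c))"
      unfolding T by (intro range_eqI[where x = "k * (a - c)"]) (rule sym)
  next
    fix T assume "T \<in> range (\<lambda>a. ?g (m * a + c))"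
    then show "T \<in> range ?g" by blast
  qed
  moreover have "\<sigma> ` ?h a = ?g (m * a + c)" for a
    by (simp add: \<sigma> algebra_simps)
  ultimately have "(`) \<sigma> ` range ?h = range ?g"
    by (simp add: image_image)
  moreover have "rename_vars \<sigma> (anf_of (range ?h)) = anf_of ((`) \<sigma> ` range ?h)"
    by (rule rename_vars_anf_of[of "{1..p}"]) (use assms(1,2) vertex_in[OF assms(1)] in auto)
  ultimately show ?thesis
    by (simp add: triple_fun_def)
qed

lemma inj_on_cyc_shift:
  assumes "p > 0"
  shows "inj_on (\<lambda>i. cyc p (i + t)) {1..p}"
proof (rule inj_onI)
  fix x y assume xy: "x \<in> {1..p}" "y \<in> {1..p}" "cyc p (x + t) = cyc p (y + t)"
  then have "vertex p (int x) = vertex p (int y)"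
    using assms by (simp add: cyc_eq_vertex vertex_eq_iff cong_add_rcancel)
  then show "x = y" using xy by (simp add: vertex_of_nat)
qed

lemma rotation_symmetric_triple_fun:
  assumes "p > 0"
  shows "rotation_symmetric p (triple_fun p u v)"
  unfolding rotation_symmetric_def
proof
  fix t
  have rot: "cyc p (vertex p x + t) = vertex p (1 * x + int t)" for x
    using assms by (simp add: cyc_eq_vertex vertex_eq_iff cong_add_rcancel cong_int_vertex)
  from rename_triple_fun[OF assms inj_on_cyc_shift[OF assms] _ rot]
  show "rename_vars (\<lambda>i. cyc p (i + t)) (triple_fun p u v) = triple_fun p u v"
    by simp
qed

text \<open>Nondegeneracy makes the three variables of every product different, so a product is
  determined by its set of labels and determines it. The sum over a set of polynomials thus becomes
  a sum over a set of triples.\<close>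

lemma mrs_eq_triple_fun:
  assumes "p > 0" "nondegenerate p (int j - int i) (int k - int i)"
  shows "mrs p i j k = triple_fun p (int j - int i) (int k - int i)"
proof -
  let ?S = "\<lambda>t. {cyc p (i + t), cyc p (j + t), cyc p (k + t)}"
  have ne: "\<not> [int j = int i] (mod int p)" "\<not> [int k = int i] (mod int p)"
      "\<not> [int j = int k] (mod int p)"
    using assms(2) by (auto simp: nondegenerate_def cong_iff_dvd_diff)
  have mon: "var (cyc p (i + t)) * var (cyc p (j + t)) * var (cyc p (k + t))
      = (\<Prod>x\<in>?S t. var x)" for t
    using ne assms(1) by (simp add: cyc_eq_vertex vertex_eq_iff cong_add_rcancel cong_sym_eq mult.assoc)
  have inj: "inj_on (\<lambda>T. \<Prod>x\<in>T. var x) (?S ` {0..<p})"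
  proof (rule inj_onI)
    fix T U assume "T \<in> ?S ` {0..<p}" "U \<in> ?S ` {0..<p}" "(\<Prod>x\<in>T. var x) = (\<Prod>x\<in>U. var x)"
    then have fin: "finite T" "finite U" and "Poly_Mapping.single (expo T) (1::bit) = Poly_Mapping.single (expo U) 1"
      by (auto simp: prod_var)
    then have "expo T = expo U"
      by (metis keys_single singleton_inject one_neq_zero)
    then show "T = U" using fin by (metis keys_expo)
  qed
  have "mrs p i j k = \<Sum>((\<lambda>T. \<Prod>x\<in>T. var x) ` ?S ` {0..<p})"
    unfolding mrs_def mon by (simp add: image_image)
  also have "\<dots> = anf_of (?S ` {0..<p})"
    unfolding anf_of_def by (simp only: sum.reindex[OF inj] o_def id_def)
  also have "?S ` {0..<p} =
      range (\<lambda>a. {vertex p a, vertex p (a + (int j - int i)), vertex p (a + (int k - int i))})"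
    (is "_ = range ?h")
  proof -
    have S: "?S t = ?h (int i + int t)" for t
      using assms(1) by (simp add: cyc_eq_vertex algebra_simps)
    have "?h a = ?S (nat ((a - int i) mod int p))" for a
    proof -
      have "[int i + (a - int i) mod int p = int i + (a - int i)] (mod int p)"
        by (intro cong_add) (auto simp: cong_def)
      then have "[int i + int (nat ((a - int i) mod int p)) = a] (mod int p)"
        using assms(1) by simp
      then show ?thesis unfolding S by (rule triple_cong[OF assms(1), symmetric])
    qed
    moreover have "nat ((a - int i) mod int p) \<in> {0..<p}" for a
      using assms(1) by (simp add: nat_less_iff)
    ultimately have "range ?h \<subseteq> ?S ` {0..<p}" by blast
    moreover have "?S ` {0..<p} \<subseteq> range ?h" unfolding S by blast
    ultimately show ?thesis by blast
  qed
  finally show ?thesis by (simp add: triple_fun_def)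
qed

text \<open>If the functions agree, the triple based at 0 of one is a triple of the other. Its
  points \<open>0\<close>, \<open>u'\<close>, \<open>v'\<close> match \<open>0\<close>,
  \<open>u\<close>, \<open>v\<close> in some order up to a translation, and the six orders give the
  six pairs of differences.\<close>

lemma triple_fun_eq_iff:
  assumes p: "p > 0" and nd: "nondegenerate p u v" "nondegenerate p u' v'"
  shows "triple_fun p u' v' = triple_fun p u v \<longleftrightarrow>
    (\<exists>(x, y) \<in> {(u, v), (v, u), (- u, v - u), (v - u, - u), (- v, u - v), (u - v, - v)}.
       [u' = x] (mod int p) \<and> [v' = y] (mod int p))"
proof
  let ?h = "\<lambda>u v a. {vertex p a, vertex p (a + u), vertex p (a + v)}"
  assume "triple_fun p u' v' = triple_fun p u v"
  then have "range (?h u' v') = range (?h u v)"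
    unfolding triple_fun_def by (simp only: anf_of_eq_iff finite_Union_triples[OF p])
  then obtain a where a: "?h u' v' 0 = ?h u v a" by blast
  have ex: "\<exists>s\<in>{0, u, v}. [x = a + s] (mod int p)" if "vertex p x \<in> ?h u v a" for x
    using that p by (auto simp: vertex_eq_iff)
  obtain r s t where rst: "r \<in> {0, u, v}" "s \<in> {0, u, v}" "t \<in> {0, u, v}"
    and c: "[0 = a + r] (mod int p)" "[u' = a + s] (mod int p)" "[v' = a + t] (mod int p)"
  proof -
    have "vertex p 0 \<in> ?h u v a" "vertex p u' \<in> ?h u v a" "vertex p v' \<in> ?h u v a"
      unfolding a[symmetric] by simp_all
    from ex[OF this(1)] ex[OF this(2)] ex[OF this(3)] show thesis
      using that by blast
  qed
  have uv: "[u' = s - r] (mod int p)" "[v' = t - r] (mod int p)"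
    using cong_diff[OF c(2,1)] cong_diff[OF c(3,1)] by simp_all
  have "s \<noteq> r" "t \<noteq> r" "s \<noteq> t"
    using nd(2) uv by (auto simp: nondegenerate_def intro: cong_trans cong_sym)
  then show "\<exists>(x, y) \<in> {(u, v), (v, u), (- u, v - u), (v - u, - u), (- v, u - v), (u - v, - v)}.
       [u' = x] (mod int p) \<and> [v' = y] (mod int p)"
    using rst uv by auto
next
  assume "\<exists>(x, y) \<in> {(u, v), (v, u), (- u, v - u), (v - u, - u), (- v, u - v), (u - v, - v)}.
       [u' = x] (mod int p) \<and> [v' = y] (mod int p)"
  then obtain x y where xy: "(x, y) \<in> {(u, v), (v, u), (- u, v - u), (v - u, - u), (- v, u - v), (u - v, - v)}"
    and c: "[u' = x] (mod int p)" "[v' = y] (mod int p)"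
    by blast
  have "triple_fun p x y = triple_fun p u v"
    using xy triple_fun_swap[of p v u] triple_fun_shift[of p u v]
      triple_fun_swap[of p "v - u" "- u"] triple_fun_shift[of p v u]
      triple_fun_swap[of p "u - v" "- v"] by auto
  then show "triple_fun p u' v' = triple_fun p u v"
    using triple_fun_cong[OF p c] by simp
qed

section \<open>Permutations preserving rotation symmetry\<close>

lemma cong_small_imp_eq:
  fixes x y m :: int
  assumes "[x = y] (mod m)" "\<bar>x - y\<bar> < m"
  shows "x = y"
  using assms zdvd_not_zless[of "\<bar>x - y\<bar>" m] by (auto simp: cong_iff_dvd_diff)

locale prime_gt_3 =
  fixes p :: nat
  assumes prime_p: "prime p" and p_gt_3: "p > 3"
begin

lemma p_pos: "p > 0"
  using p_gt_3 by simp

lemma p_ge_5: "p \<ge> 5"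
proof -
  have "p \<noteq> 4" using prime_p by auto
  then show ?thesis using p_gt_3 by simp
qed

lemma prime_int_p: "prime (int p)"
  using prime_p by simp

text \<open>Supplies the invertibility of the constants 1, 2 and 3; the bound is the smallest
  admissible prime.\<close>

lemma small_not_cong_0: "\<bar>x\<bar> < 5 \<Longrightarrow> [x = 0] (mod int p) \<Longrightarrow> x = 0"
  using cong_small_imp_eq[of x 0 "int p"] p_ge_5 by simp

lemma cong_mult_eq_0_iff: "[x * y = 0] (mod int p) \<longleftrightarrow> [x = 0] (mod int p) \<or> [y = 0] (mod int p)"
  by (simp add: cong_0_iff prime_dvd_mult_iff[OF prime_int_p])

lemma coprime_iff_not_cong_0: "coprime x (int p) \<longleftrightarrow> \<not> [x = 0] (mod int p)"
proof (cases "int p dvd x")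
  case True
  then have "\<not> coprime x (int p)"
    using coprime_common_divisor[of x "int p" "int p"] p_gt_3 by auto
  then show ?thesis using True by (simp add: cong_0_iff)
next
  case False
  then have "coprime x (int p)"
    using prime_imp_coprime[OF prime_int_p] by (simp add: coprime_commute)
  then show ?thesis using False by (simp add: cong_0_iff)
qed

lemma obtain_inverse:
  assumes "\<not> [x = 0] (mod int p)"
  obtains y where "[x * y = 1] (mod int p)"
  using assms coprime_iff_not_cong_0 cong_solve_coprime_int by blast

text \<open>Neighbours have neighbouring images, and by injectivity two successive steps cannot
  cancel: \<open>g (n + 2)\<close> would equal \<open>g n\<close>. So the first step
  \<open>e\<close> is repeated all the way round.\<close>

lemma preserves_consecutive_triples_imp_dihedral:
  assumes cong: "\<And>x y. [x = y] (mod int p) \<Longrightarrow> [g x = g y] (mod int p)"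
    and inj: "\<And>x y. [g x = g y] (mod int p) \<Longrightarrow> [x = y] (mod int p)"
    and triple: "\<And>a. \<exists>b. \<forall>x\<in>{a, a + 1, a + 2}. \<exists>i\<in>{0, 1, 2}. [g x = b + i] (mod int p)"
  obtains e where "e \<in> {1, -1 :: int}" "\<And>x. [g x = g 0 + e * x] (mod int p)"
proof -
  have triple': "\<exists>b. \<exists>i0\<in>{0, 1, 2}. \<exists>i1\<in>{0, 1, 2}. \<exists>i2\<in>{0, 1, 2}. [g a = b + i0] (mod int p) \<and>
      [g (a + 1) = b + i1] (mod int p) \<and> [g (a + 2) = b + i2] (mod int p)" for a
    using triple[of a] by (simp only: ball_simps simp_thms) blast
  have step: "\<exists>e\<in>{1, -1}. [g (a + 1) - g a = e] (mod int p)" for a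
  proof -
    have inj': "x = y" if "[g x = g y] (mod int p)" "\<bar>x - y\<bar> < 5" for x y
      using cong_small_imp_eq[OF inj[OF that(1)]] that(2) p_ge_5 by simp
    obtain b i0 i1 i2 where
      b: "[g a = b + i0] (mod int p)" "[g (a + 1) = b + i1] (mod int p)" "[g (a + 2) = b + i2] (mod int p)"
      and i: "i0 \<in> {0, 1, 2}" "i1 \<in> {0, 1, 2}" "i2 \<in> {0, 1, 2}"
      using triple'[of a] by blast
    obtain b' j0 j1 j2 where
      b': "[g (a - 1) = b' + j0] (mod int p)" "[g a = b' + j1] (mod int p)" "[g (a + 1) = b' + j2] (mod int p)"
      and j: "j0 \<in> {0, 1, 2}" "j1 \<in> {0, 1, 2}" "j2 \<in> {0, 1, 2}"
    proof -
      have "a - 1 + 1 = a" "a - 1 + 2 = a + 1" by simp_all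
      then show thesis using that triple'[of "a - 1"] by metis
    qed
    have neq: "i \<noteq> j" if "[g x = b + i] (mod int p)" "[g y = b + j] (mod int p)"
      "x \<noteq> y" "\<bar>x - y\<bar> < 5" for i j x y b
    proof
      assume "i = j"
      then have "[g x = g y] (mod int p)" using that(1,2) by (meson cong_sym cong_trans)
      then show False using inj' that(3,4) by blast
    qed
    have ne: "i0 \<noteq> i1" "i0 \<noteq> i2" "i1 \<noteq> i2" "j0 \<noteq> j1" "j0 \<noteq> j2" "j1 \<noteq> j2"
      using neq[OF b(1,2)] neq[OF b(1,3)] neq[OF b(2,3)]
        neq[OF b'(1,2)] neq[OF b'(1,3)] neq[OF b'(2,3)] by simp_all
    have d: "[g (a + 1) - g a = i1 - i0] (mod int p)" "[g (a + 1) - g a = j2 - j1] (mod int p)"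
      using cong_diff[OF b(2,1)] cong_diff[OF b'(3,2)] by simp_all
    have rng: "0 \<le> k \<and> k \<le> 2" if "k \<in> {0, 1, 2}" for k :: int
      using that by auto
    have bounds: "0 \<le> i0" "i0 \<le> 2" "0 \<le> i1" "i1 \<le> 2" "0 \<le> i2" "i2 \<le> 2"
        "0 \<le> j0" "j0 \<le> 2" "0 \<le> j1" "j1 \<le> 2" "0 \<le> j2" "j2 \<le> 2"
      using i[THEN rng] j[THEN rng] by blast+
    have "[i1 - i0 = j2 - j1] (mod int p)"
      using d by (meson cong_sym cong_trans)
    \<comment> \<open>Both sides lie between -2 and 2, so they differ by at most 4, which is less
      than \<open>p\<close>.\<close>
    then have eq: "i1 - i0 = j2 - j1"
      by (rule cong_small_imp_eq) (use bounds p_ge_5 in linarith)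
    \<comment> \<open>If \<open>g a\<close> and \<open>g (a + 1)\<close> were at distance 2, both triples containing them would have
      the same image.\<close>
    show ?thesis
    proof (cases "\<bar>i1 - i0\<bar> = 2")
      case True
      then consider "i0 = 0" "i1 = 2" "j1 = 0" "j2 = 2" | "i0 = 2" "i1 = 0" "j1 = 2" "j2 = 0"
        using bounds eq by linarith
      then have ij: "j1 = i0" "j0 = 1" "i2 = 1"
        using i(3) j(1) ne by (cases; auto)+
      have "[b + i0 = b' + i0] (mod int p)"
        using b(1) b'(2) ij by (meson cong_sym cong_trans)
      then have "[b + 1 = b' + 1] (mod int p)"
        by (simp add: cong_add_rcancel)
      \<comment> \<open>Only the middle of the common image is left, and both \<open>a - 1\<close>
        and \<open>a + 2\<close> must go there.\<close>
      then have "[g (a - 1) = g (a + 2)] (mod int p)"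
        using b(3) b'(1) ij by (metis cong_sym cong_trans)
      then have False using inj'[of "a - 1" "a + 2"] by simp
      then show ?thesis ..
    next
      case False
      then have "i1 - i0 = 1 \<or> i1 - i0 = -1" using bounds(1-4) ne(1) by linarith
      then show ?thesis using d(1) by blast
    qed
  qed
  obtain e where e: "e \<in> {1, -1}" "[g (0 + 1) - g 0 = e] (mod int p)"
    using step by blast
  have same: "[g (int n + 1) - g (int n) = e] (mod int p)" for n
  proof (induction n)
    case 0
    then show ?case using e(2) by simp
  next
    case (Suc n)
    obtain e' where e': "e' \<in> {1, -1}" "[g (int (Suc n) + 1) - g (int (Suc n)) = e'] (mod int p)"
      using step by blast
    have "e' = e"
    proof (rule ccontr)
      assume "e' \<noteq> e"
      then have "e' + e = 0" using e(1) e'(1) by auto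
      then have "[g (int n + 2) - g (int n) = 0] (mod int p)"
        using cong_add[OF e'(2) Suc.IH] by (simp add: algebra_simps)
      then have "[int n + 2 = int n] (mod int p)"
        using inj by (simp add: cong_diff_iff_cong_0)
      then show False using cong_small_imp_eq[of "int n + 2" "int n" "int p"] p_ge_5 by simp
    qed
    then show ?case using e'(2) by simp
  qed
  have nat: "[g (int n) = g 0 + e * int n] (mod int p)" for n
  proof (induction n)
    case 0
    then show ?case by simp
  next
    case (Suc n)
    from cong_add[OF Suc.IH same[of n]] show ?case by (simp add: algebra_simps)
  qed
  have "[g x = g 0 + e * x] (mod int p)" for x
  proof -
    have n: "[int (nat (x mod int p)) = x] (mod int p)"
      using p_pos by (simp add: cong_def)
    have "[g x = g (int (nat (x mod int p)))] (mod int p)"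
      using cong[OF n] by (rule cong_sym)
    also have "[g (int (nat (x mod int p))) = g 0 + e * int (nat (x mod int p))] (mod int p)"
      by (rule nat)
    also have "[g 0 + e * int (nat (x mod int p)) = g 0 + e * x] (mod int p)"
      by (intro cong_add cong_mult n cong_refl)
    finally show ?thesis .
  qed
  then show thesis using that e(1) by blast
qed

lemma preserves_rotation_symmetry_imp_affine:
  assumes "preserves_rotation_symmetry p \<sigma>"
  obtains m c where "\<not> [m = 0] (mod int p)" "\<And>x. \<sigma> (vertex p x) = vertex p (m * x + c)"
proof -
  let ?h = "\<lambda>a. {vertex p a, vertex p (a + 1), vertex p (a + 2)}"
  let ?rot = "\<lambda>i. cyc p (i + 1)"
  define U where "U = (`) \<sigma> ` range ?h"
  define \<pi> where "\<pi> = inv \<sigma>"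
  \<comment> \<open>\<open>g\<close> is the rotation conjugated by \<open>\<sigma>\<close>, and
    \<open>s\<close> below is \<open>\<sigma>\<close> itself, both read on residues; they are linked
    by \<open>s (g x) = s x + 1\<close>.\<close>
  define g where "g x = int (\<pi> (?rot (\<sigma> (vertex p x))))" for x
  define s where "s x = int (\<sigma> (vertex p x))" for x
  have perm: "\<sigma> permutes {1..p}" and rot_sym: "\<And>f. f \<in> cubic_mrs p \<Longrightarrow> rotation_symmetric p (rename_vars \<sigma> f)"
    using assms by (auto simp: preserves_rotation_symmetry_def)
  have perm': "\<pi> permutes {1..p}"
    unfolding \<pi>_def using perm by (rule permutes_inv)
  have \<pi>\<sigma>: "\<pi> (\<sigma> i) = i" and \<sigma>\<pi>: "\<sigma> (\<pi> i) = i" for i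
    unfolding \<pi>_def using permutes_inverses[OF perm] by simp_all
  have in\<sigma>: "\<sigma> (vertex p x) \<in> {1..p}" for x
    using vertex_in[OF p_pos] permutes_in_image[OF perm] by blast
  have rot_in: "?rot i \<in> {1..p}" for i
    using cyc_eq_vertex[OF p_pos] vertex_in[OF p_pos] by simp
  have vertex_s: "vertex p (s x) = \<sigma> (vertex p x)" for x
    unfolding s_def using in\<sigma> by (rule vertex_of_nat)
  have vertex_g: "vertex p (g x) = \<pi> (?rot (\<sigma> (vertex p x)))" for x
    unfolding g_def using rot_in permutes_in_image[OF perm'] by (intro vertex_of_nat) blast
  have s_g: "[s (g x) = s x + 1] (mod int p)" for x
  proof -
    have "vertex p (s (g x)) = ?rot (\<sigma> (vertex p x))"
      unfolding vertex_s vertex_g \<sigma>\<pi> ..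
    also have "\<dots> = vertex p (s x + 1)"
      by (simp add: cyc_eq_vertex p_pos s_def add.commute)
    finally show ?thesis by (simp add: vertex_eq_iff p_pos)
  qed
  have s_cong_iff: "[s x = s y] (mod int p) \<longleftrightarrow> [x = y] (mod int p)" for x y
    using vertex_eq_iff[OF p_pos, of "s x" "s y"] vertex_eq_iff[OF p_pos, of x y] \<pi>\<sigma>
    unfolding vertex_s by metis
  have g_cong_iff: "[g x = g y] (mod int p) \<longleftrightarrow> [x = y] (mod int p)" for x y
  proof -
    have "[g x = g y] (mod int p) \<longleftrightarrow> [s (g x) = s (g y)] (mod int p)"
      by (simp add: s_cong_iff)
    also have "\<dots> \<longleftrightarrow> [s x + 1 = s y + 1] (mod int p)"
      using s_g[of x] s_g[of y] by (meson cong_sym cong_trans)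
    finally show ?thesis by (simp add: cong_add_rcancel s_cong_iff)
  qed
  have nd: "nondegenerate p (int 2 - int 1) (int 3 - int 1)"
    using small_not_cong_0[of 1] small_not_cong_0[of 2] cong_small_imp_eq[of 1 2 "int p"] p_ge_5
    by (auto simp: nondegenerate_def)
  have "mrs p 1 2 3 \<in> cubic_mrs p"
    using p_gt_3 by (force simp: cubic_mrs_def)
  then have cubic: "triple_fun p 1 2 \<in> cubic_mrs p"
    using mrs_eq_triple_fun[OF p_pos nd] by simp
  have ren: "rename_vars \<sigma> (triple_fun p 1 2) = anf_of U"
    unfolding triple_fun_def U_def
    by (rule rename_vars_anf_of[of "{1..p}"])
      (use vertex_in[OF p_pos] permutes_inj_on[OF perm] in auto)
  have U_sub: "\<Union>U \<subseteq> {1..p}"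
    unfolding U_def using in\<sigma> by auto
  then have fin: "finite (\<Union>U)"
    by (rule finite_subset) simp
  then have fin': "finite (\<Union>((`) ?rot ` U))"
    unfolding image_Union[symmetric] by (rule finite_imageI)
  have "anf_of ((`) ?rot ` U) = rename_vars ?rot (anf_of U)"
    by (rule rename_vars_anf_of[OF _ U_sub inj_on_cyc_shift[OF p_pos], symmetric]) simp
  also have "\<dots> = anf_of U"
    using rot_sym[OF cubic] unfolding rotation_symmetric_def ren by blast
  finally have U: "(`) ?rot ` U = U"
    by (simp only: anf_of_eq_iff[OF fin' fin])
  have triple: "\<exists>b. \<forall>x\<in>{a, a + 1, a + 2}. \<exists>i\<in>{0, 1, 2}. [g x = b + i] (mod int p)" for a
  proof -
    have "\<sigma> ` ?h a \<in> U" unfolding U_def by blast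
    then have "?rot ` \<sigma> ` ?h a \<in> U" by (subst U[symmetric]) (rule imageI)
    then obtain b where b: "?rot ` \<sigma> ` ?h a = \<sigma> ` ?h b" unfolding U_def by blast
    have "\<exists>i\<in>{0, 1, 2}. [g x = b + i] (mod int p)" if "x \<in> {a, a + 1, a + 2}" for x
    proof -
      have "?rot (\<sigma> (vertex p x)) \<in> \<sigma> ` ?h b" unfolding b[symmetric] using that by blast
      then have "vertex p (g x) \<in> ?h b" unfolding vertex_g using \<pi>\<sigma> by auto
      then show ?thesis using p_pos by (auto simp: vertex_eq_iff)
    qed
    then show ?thesis by blast
  qed
  obtain e where e: "e \<in> {1, -1 :: int}" "\<And>x. [g x = g 0 + e * x] (mod int p)"
    using preserves_consecutive_triples_imp_dihedral[of g] g_cong_iff triple by blast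
  have no_fixpoint: "\<not> [g x = x] (mod int p)" for x
  proof
    assume "[g x = x] (mod int p)"
    then have "[s x + 1 = s x] (mod int p)"
      using s_g[of x] s_cong_iff[of "g x" x] by (meson cong_sym cong_trans)
    then show False using small_not_cong_0[of 1] by (simp add: cong_iff_dvd_diff)
  qed
  have "e = 1"
  proof (rule ccontr)
    assume "e \<noteq> 1"
    then have e': "e = -1" using e(1) by simp
    \<comment> \<open>\<open>h\<close> is one half, so \<open>g 0 * h\<close> is the centre of the
      reflection \<open>x \<mapsto> g 0 - x\<close>.\<close>
    obtain h where h: "[2 * h = 1] (mod int p)"
      using obtain_inverse[of 2] small_not_cong_0[of 2] by auto
    have "[g (g 0 * h) = g 0 * 1 - g 0 * h] (mod int p)"
      using e(2)[of "g 0 * h"] e' by simp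
    also have "[g 0 * 1 - g 0 * h = g 0 * (2 * h) - g 0 * h] (mod int p)"
      by (intro cong_diff cong_mult cong_refl cong_sym[OF h])
    finally show False using no_fixpoint[of "g 0 * h"] by (simp add: algebra_simps)
  qed
  then have shift: "[s (x + g 0) = s x + 1] (mod int p)" for x
    using e(2)[of x] s_g[of x] s_cong_iff[of "g x" "x + g 0"]
    by (metis add.commute cong_sym cong_trans mult_1)
  have nat: "[s (int n * g 0) = s 0 + int n] (mod int p)" for n
  proof (induction n)
    case 0
    then show ?case by simp
  next
    case (Suc n)
    have "[s (int n * g 0 + g 0) = s (int n * g 0) + 1] (mod int p)" by (rule shift)
    also have "[s (int n * g 0) + 1 = s 0 + int n + 1] (mod int p)"
      by (intro cong_add Suc.IH cong_refl)
    finally show ?case by (simp add: algebra_simps)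
  qed
  \<comment> \<open>Otherwise 0 would be a fixed point of \<open>g\<close>. The inverse
    \<open>m\<close> of the translation length is the slope of \<open>\<sigma>\<close>.\<close>
  have "\<not> [g 0 = 0] (mod int p)" by (rule no_fixpoint)
  then obtain m where m: "[g 0 * m = 1] (mod int p)" by (rule obtain_inverse)
  have "[s x = m * x + s 0] (mod int p)" for x
  proof -
    \<comment> \<open>\<open>x\<close> is reached from 0 by \<open>x * m\<close> translations of
      length \<open>g 0\<close>, each of which advances \<open>s\<close> by 1.\<close>
    let ?n = "nat (x * m mod int p)"
    have n: "[int ?n = x * m] (mod int p)"
      using p_pos by (simp add: cong_def)
    have "[int ?n * g 0 = x * m * g 0] (mod int p)"
      by (intro cong_mult n cong_refl)
    also have "[x * m * g 0 = x * 1] (mod int p)"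
      using cong_mult[OF cong_refl[of x] m] by (simp add: mult_ac)
    finally have "[s x = s (int ?n * g 0)] (mod int p)"
      by (simp add: s_cong_iff cong_sym)
    also have "[s (int ?n * g 0) = s 0 + int ?n] (mod int p)" by (rule nat)
    also have "[s 0 + int ?n = s 0 + x * m] (mod int p)" by (intro cong_add n cong_refl)
    finally show ?thesis by (simp add: algebra_simps)
  qed
  then have "\<sigma> (vertex p x) = vertex p (m * x + s 0)" for x
    unfolding vertex_s[symmetric] vertex_eq_iff[OF p_pos] .
  moreover have "\<not> [m = 0] (mod int p)"
  proof
    assume "[m = 0] (mod int p)"
    then have "[g 0 * m = 0] (mod int p)" by (simp add: cong_mult_eq_0_iff)
    then have "[1 = 0] (mod int p)" using m by (meson cong_sym cong_trans)
    then show False using small_not_cong_0[of 1] by simp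
  qed
  ultimately show thesis using that by blast
qed

section \<open>Scalings, and equivalence classes as orbits of scalings\<close>

lemma obtain_scaling:
  assumes "\<not> [m = 0] (mod int p)"
  obtains \<sigma> where "\<sigma> permutes {1..p}" "\<And>x. \<sigma> (vertex p x) = vertex p (m * x)"
proof
  let ?\<sigma> = "\<lambda>i. if i \<in> {1..p} then vertex p (m * int i) else i"
  have inj: "inj_on ?\<sigma> {1..p}"
  proof (rule inj_onI)
    fix x y assume xy: "x \<in> {1..p}" "y \<in> {1..p}" "?\<sigma> x = ?\<sigma> y"
    then have "[m * int x = m * int y] (mod int p)"
      by (simp add: vertex_eq_iff p_pos)
    then have "[int x = int y] (mod int p)"
      using cong_mult_lcancel[of m "int p"] coprime_iff_not_cong_0 assms by blast
    then have "vertex p (int x) = vertex p (int y)"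
      by (simp add: vertex_eq_iff p_pos)
    then show "x = y" using xy by (simp only: vertex_of_nat)
  qed
  have "?\<sigma> ` {1..p} \<subseteq> {1..p}"
    using vertex_in[OF p_pos] by auto
  then have "?\<sigma> ` {1..p} = {1..p}"
    using inj by (intro endo_inj_surj) simp_all
  then show "?\<sigma> permutes {1..p}"
    using inj by (intro bij_imp_permutes bij_betw_imageI) (simp_all only: if_False)
  show "?\<sigma> (vertex p x) = vertex p (m * x)" for x
    using vertex_in[OF p_pos, of x] cong_mult[OF cong_refl[of m] cong_int_vertex[OF p_pos, of x]]
    by (simp only: if_True vertex_eq_iff[OF p_pos])
qed

lemma rename_triple_fun_affine:
  assumes "\<sigma> permutes {1..p}" "\<not> [m = 0] (mod int p)"
    and "\<And>x. \<sigma> (vertex p x) = vertex p (m * x + c)"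
  shows "rename_vars \<sigma> (triple_fun p u v) = triple_fun p (m * u) (m * v)"
  using rename_triple_fun[OF p_pos permutes_inj_on[OF assms(1)]] assms(2,3) coprime_iff_not_cong_0
  by blast

lemma nondegenerate_mult:
  "nondegenerate p u v \<Longrightarrow> \<not> [m = 0] (mod int p) \<Longrightarrow> nondegenerate p (m * u) (m * v)"
  unfolding nondegenerate_def using coprime_iff_not_cong_0
  by (simp add: cong_mult_eq_0_iff cong_mult_lcancel)

text \<open>Every translation class contains the triple based at 1, and that triple supplies
  \<open>j\<close> and \<open>k\<close>. Fixing the first index as 1 therefore loses no
  function.\<close>

lemma cubic_mrs_eq: "cubic_mrs p = {triple_fun p u v |u v. nondegenerate p u v}"
proof (intro equalityI subsetI)
  fix f assume "f \<in> cubic_mrs p"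
  then obtain j k where f: "f = mrs p 1 j k" and jk: "j \<in> {1..p}" "k \<in> {1..p}" "distinct [1, j, k]"
    by (auto simp: cubic_mrs_def)
  have neq: "\<not> [int x = int y] (mod int p)" if "x \<in> {1..p}" "y \<in> {1..p}" "x \<noteq> y" for x y
    using that vertex_of_nat[of x p] vertex_of_nat[of y p] vertex_eq_iff[OF p_pos] by metis
  have "nondegenerate p (int j - int 1) (int k - int 1)"
    using neq[of j 1] neq[of k 1] neq[of j k] jk p_pos
    by (simp add: nondegenerate_def cong_iff_dvd_diff)
  with mrs_eq_triple_fun[OF p_pos this] f show "f \<in> {triple_fun p u v |u v. nondegenerate p u v}"
    by blast
next
  fix f assume "f \<in> {triple_fun p u v |u v. nondegenerate p u v}"
  then obtain u v where f: "f = triple_fun p u v" and nd: "nondegenerate p u v" by blast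
  define j where "j = vertex p (1 + u)"
  define k where "k = vertex p (1 + v)"
  have cong: "[int j - int 1 = u] (mod int p)" "[int k - int 1 = v] (mod int p)"
    using cong_diff[OF cong_int_vertex[OF p_pos, of "1 + u"] cong_refl[of 1]]
      cong_diff[OF cong_int_vertex[OF p_pos, of "1 + v"] cong_refl[of 1]]
    by (simp_all add: j_def k_def)
  have nd': "nondegenerate p (int j - int 1) (int k - int 1)"
    using nd cong unfolding nondegenerate_def by (meson cong_sym cong_trans)
  then have "distinct [1, j, k]"
    by (auto simp: nondegenerate_def)
  moreover have "j \<in> {1..p}" "k \<in> {1..p}"
    unfolding j_def k_def using vertex_in[OF p_pos] by blast+
  ultimately have "mrs p 1 j k \<in> cubic_mrs p"
    unfolding cubic_mrs_def by blast
  moreover have "mrs p 1 j k = f"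
    unfolding f mrs_eq_triple_fun[OF p_pos nd'] by (rule triple_fun_cong[OF p_pos cong])
  ultimately show "f \<in> cubic_mrs p" by simp
qed

lemma scaling_preserves:
  assumes "\<sigma> permutes {1..p}" "\<not> [m = 0] (mod int p)"
    and "\<And>x. \<sigma> (vertex p x) = vertex p (m * x)"
  shows "preserves_rotation_symmetry p \<sigma>"
  using assms rename_triple_fun_affine[OF assms(1,2), of 0] rotation_symmetric_triple_fun[OF p_pos]
  by (auto simp: preserves_rotation_symmetry_def cubic_mrs_eq)

text \<open>An equivalence is realised by an affine map, whose translation part does not change a
  translation class; conversely, every scaling sends translation classes to translation classes,
  which are rotation symmetric.\<close>

lemma mrs_equiv_image:
  assumes nd: "nondegenerate p u v"
  shows "mrs_equiv p `` {triple_fun p u v} =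
    {triple_fun p (m * u) (m * v) |m. \<not> [m = 0] (mod int p)}"
proof (intro equalityI subsetI)
  fix g assume "g \<in> mrs_equiv p `` {triple_fun p u v}"
  then obtain \<sigma> where \<sigma>: "preserves_rotation_symmetry p \<sigma>" and g: "g = rename_vars \<sigma> (triple_fun p u v)"
    by (auto simp: mrs_equiv_def)
  obtain m c where m: "\<not> [m = 0] (mod int p)" "\<And>x. \<sigma> (vertex p x) = vertex p (m * x + c)"
    using preserves_rotation_symmetry_imp_affine[OF \<sigma>] by blast
  have "\<sigma> permutes {1..p}" using \<sigma> by (simp add: preserves_rotation_symmetry_def)
  then show "g \<in> {triple_fun p (m * u) (m * v) |m. \<not> [m = 0] (mod int p)}"
    using rename_triple_fun_affine[OF _ m] m(1) g by blast
next
  fix g assume "g \<in> {triple_fun p (m * u) (m * v) |m. \<not> [m = 0] (mod int p)}"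
  then obtain m where m: "\<not> [m = 0] (mod int p)" and g: "g = triple_fun p (m * u) (m * v)"
    by blast
  obtain \<sigma> where \<sigma>: "\<sigma> permutes {1..p}" "\<And>x. \<sigma> (vertex p x) = vertex p (m * x)"
    using obtain_scaling[OF m] by blast
  have "rename_vars \<sigma> (triple_fun p u v) = g"
    using rename_triple_fun_affine[OF \<sigma>(1) m, of 0] \<sigma>(2) g by simp
  moreover have "triple_fun p u v \<in> cubic_mrs p" "g \<in> cubic_mrs p"
    unfolding cubic_mrs_eq g using nd nondegenerate_mult[OF nd m] by blast+
  ultimately show "g \<in> mrs_equiv p `` {triple_fun p u v}"
    using scaling_preserves[OF \<sigma>(1) m \<sigma>(2)] by (auto simp: mrs_equiv_def)
qed

section \<open>Classes and ratios\<close>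

text \<open>Representatives of the residues other than 0 and 1; for these two values the third point
  of a triple would coincide with its first or second point.\<close>

definition ratios :: "int set" where
  "ratios = {2..<int p}"

definition ratio_class :: "int \<Rightarrow> anf set" where
  "ratio_class l = {triple_fun p w (w * l) |w. \<not> [w = 0] (mod int p)}"

lemma ratioD:
  assumes "l \<in> ratios"
  shows "\<not> [l = 0] (mod int p)" "\<not> [l = 1] (mod int p)" "l mod int p = l"
  using assms cong_small_imp_eq[of l 0 "int p"] cong_small_imp_eq[of l 1 "int p"]
  by (auto simp: ratios_def)

lemma mod_in_ratios:
  assumes "\<not> [x = 0] (mod int p)" "\<not> [x = 1] (mod int p)"
  shows "x mod int p \<in> ratios"
proof -
  have "x mod int p \<noteq> 0" "x mod int p \<noteq> 1"
    using assms p_gt_3 by (auto simp: cong_def)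
  moreover have "0 \<le> x mod int p" "x mod int p < int p"
    using p_pos by simp_all
  ultimately show ?thesis unfolding ratios_def by simp
qed

lemma nondegenerate_ratio:
  "l \<in> ratios \<Longrightarrow> \<not> [w = 0] (mod int p) \<Longrightarrow> nondegenerate p w (w * l)"
  using nondegenerate_mult[of 1 l w] small_not_cong_0[of 1] ratioD[of l]
  by (auto simp: nondegenerate_def cong_sym_eq)

lemma triple_fun_scale:
  assumes "triple_fun p u v = triple_fun p u' v'" "\<not> [m = 0] (mod int p)"
  shows "triple_fun p (m * u) (m * v) = triple_fun p (m * u') (m * v')"
proof -
  obtain \<sigma> where \<sigma>: "\<sigma> permutes {1..p}" "\<And>x. \<sigma> (vertex p x) = vertex p (m * x)"
    using obtain_scaling[OF assms(2)] by blast
  then show ?thesis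
    using rename_triple_fun_affine[OF \<sigma>(1) assms(2), of 0] assms(1) by (metis add_0_right)
qed

text \<open>As \<open>m\<close> runs through the nonzero residues, so does \<open>w = m * u\<close>.
  Hence the orbit depends only on the quotient of the two differences.\<close>

lemma ratio_class_eqI:
  assumes u: "\<not> [u = 0] (mod int p)" and uv: "[v = u * l] (mod int p)"
  shows "{triple_fun p (m * u) (m * v) |m. \<not> [m = 0] (mod int p)} = ratio_class l"
  unfolding ratio_class_def
proof (intro equalityI subsetI)
  fix f assume "f \<in> {triple_fun p (m * u) (m * v) |m. \<not> [m = 0] (mod int p)}"
  then obtain m where m: "\<not> [m = 0] (mod int p)" "f = triple_fun p (m * u) (m * v)" by blast
  have "[m * v = m * u * l] (mod int p)"
    using cong_mult[OF cong_refl[of m] uv] by (simp add: mult.assoc)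
  then have "f = triple_fun p (m * u) (m * u * l)"
    unfolding m(2) by (intro triple_fun_cong p_pos cong_refl)
  moreover have "\<not> [m * u = 0] (mod int p)"
    using m u by (simp add: cong_mult_eq_0_iff)
  ultimately show "f \<in> {triple_fun p w (w * l) |w. \<not> [w = 0] (mod int p)}" by blast
next
  fix f assume "f \<in> {triple_fun p w (w * l) |w. \<not> [w = 0] (mod int p)}"
  then obtain w where w: "\<not> [w = 0] (mod int p)" "f = triple_fun p w (w * l)" by blast
  obtain i where i: "[u * i = 1] (mod int p)" using u by (rule obtain_inverse)
  have wiu: "[w * i * u = w] (mod int p)"
    using cong_mult[OF cong_refl[of w] i] by (simp add: mult_ac)
  have "[w * i * v = w * i * (u * l)] (mod int p)"
    by (intro cong_mult uv cong_refl)
  also have "[w * i * (u * l) = w * l] (mod int p)"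
    using cong_mult[OF wiu cong_refl[of l]] by (simp add: mult_ac)
  finally have "triple_fun p (w * i * u) (w * i * v) = f"
    unfolding w(2) by (intro triple_fun_cong p_pos wiu)
  moreover have "\<not> [w * i = 0] (mod int p)"
  proof
    assume "[w * i = 0] (mod int p)"
    then have "[w * i * u = 0] (mod int p)" by (simp add: cong_mult_eq_0_iff)
    then show False using wiu w(1) by (meson cong_sym cong_trans)
  qed
  ultimately show "f \<in> {triple_fun p (m * u) (m * v) |m. \<not> [m = 0] (mod int p)}" by blast
qed

lemma ratio_class_of_member:
  assumes "triple_fun p u v \<in> ratio_class l"
  shows "{triple_fun p (m * u) (m * v) |m. \<not> [m = 0] (mod int p)} = ratio_class l"
proof -
  obtain w where w: "\<not> [w = 0] (mod int p)" "triple_fun p u v = triple_fun p w (w * l)"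
    using assms unfolding ratio_class_def by blast
  have "{triple_fun p (m * u) (m * v) |m. \<not> [m = 0] (mod int p)} =
      {triple_fun p (m * w) (m * (w * l)) |m. \<not> [m = 0] (mod int p)}"
    by (intro Collect_cong ex_cong1) (use triple_fun_scale[OF w(2)] in auto)
  then show ?thesis using ratio_class_eqI[OF w(1) cong_refl] by simp
qed

lemma obtain_ratio:
  assumes "nondegenerate p u v"
  obtains l where "l \<in> ratios" "[v = u * l] (mod int p)"
proof -
  have u: "\<not> [u = 0] (mod int p)" "\<not> [v = 0] (mod int p)" "\<not> [u = v] (mod int p)"
    using assms by (auto simp: nondegenerate_def)
  obtain i where i: "[u * i = 1] (mod int p)" using u(1) by (rule obtain_inverse)
  have eq: "[u * (i * v) = v] (mod int p)"
    using cong_mult[OF i cong_refl[of v]] by (simp add: mult_ac)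
  show thesis
  proof
    show "i * v mod int p \<in> ratios"
    proof (rule mod_in_ratios)
      show "\<not> [i * v = 0] (mod int p)"
      proof
        assume "[i * v = 0] (mod int p)"
        then have "[u * (i * v) = 0] (mod int p)" by (simp add: cong_mult_eq_0_iff)
        then show False using eq u(2) by (meson cong_sym cong_trans)
      qed
      show "\<not> [i * v = 1] (mod int p)"
      proof
        assume "[i * v = 1] (mod int p)"
        then have "[u * (i * v) = u * 1] (mod int p)" by (intro cong_mult cong_refl)
        then show False using eq u(3) by (metis cong_sym cong_trans mult_1_right)
      qed
    qed
    have "[u * (i * v mod int p) = u * (i * v)] (mod int p)"
      by (intro cong_mult cong_refl) (simp add: cong_def)
    then show "[v = u * (i * v mod int p)] (mod int p)"
      using eq by (meson cong_sym cong_trans)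
  qed
qed

lemma mrs_classes_eq: "mrs_classes p = ratio_class ` ratios"
proof (intro equalityI subsetI)
  fix C assume "C \<in> mrs_classes p"
  then obtain u v where nd: "nondegenerate p u v" and C: "C = mrs_equiv p `` {triple_fun p u v}"
    unfolding mrs_classes_def quotient_def cubic_mrs_eq by blast
  obtain l where l: "l \<in> ratios" "[v = u * l] (mod int p)" using nd by (rule obtain_ratio)
  have "C = ratio_class l"
    unfolding C mrs_equiv_image[OF nd] using nd l(2)
    by (intro ratio_class_eqI) (simp_all add: nondegenerate_def)
  then show "C \<in> ratio_class ` ratios" using l(1) by blast
next
  fix C assume "C \<in> ratio_class ` ratios"
  then obtain l where l: "l \<in> ratios" "C = ratio_class l" by blast
  have 1: "\<not> [1 = 0] (mod int p)" using small_not_cong_0[of 1] by auto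
  have nd: "nondegenerate p 1 (1 * l)"
    using nondegenerate_ratio[OF l(1) 1] .
  have "C = mrs_equiv p `` {triple_fun p 1 (1 * l)}"
    unfolding mrs_equiv_image[OF nd] l(2) by (rule ratio_class_eqI[OF 1 cong_refl, symmetric])
  then show "C \<in> mrs_classes p"
    unfolding mrs_classes_def quotient_def cubic_mrs_eq using nd by blast
qed

section \<open>The ratios that belong to one class\<close>

lemma triple_fun_1_in_ratio_class: "triple_fun p 1 l \<in> ratio_class l"
  unfolding ratio_class_def using small_not_cong_0[of 1] by force

text \<open>Reduces equality of two classes to the membership of one representative, because the
  orbit of any member is the whole class.\<close>

lemma triple_fun_1_in_ratio_class_iff:
  "triple_fun p 1 k \<in> ratio_class l \<longleftrightarrow> ratio_class k = ratio_class l"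
proof
  assume *: "triple_fun p 1 k \<in> ratio_class l"
  have "ratio_class k = {triple_fun p (m * 1) (m * k) |m. \<not> [m = 0] (mod int p)}"
    by (simp add: ratio_class_def)
  also have "\<dots> = ratio_class l" by (rule ratio_class_of_member[OF *])
  finally show "ratio_class k = ratio_class l" .
next
  assume "ratio_class k = ratio_class l"
  then show "triple_fun p 1 k \<in> ratio_class l" using triple_fun_1_in_ratio_class[of k] by simp
qed

definition ratio_orbit :: "int \<Rightarrow> int set" where
  "ratio_orbit l = {k \<in> ratios. ratio_class k = ratio_class l}"

text \<open>The six values are the ratios \<open>(c - a) / (b - a)\<close> modulo \<open>p\<close> of the six orderings of a triple.\<close>

lemma ratio_orbit_eq:
  assumes l: "l \<in> ratios" and i: "[l * i = 1] (mod int p)" and j: "[(1 - l) * j = 1] (mod int p)"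
  shows "ratio_orbit l = (\<lambda>x. x mod int p) ` {l, i, 1 - l, j, 1 - i, 1 - j}"
    (is "_ = _ ` ?S")
proof -
  have 1: "\<not> [1 = 0] (mod int p)" using small_not_cong_0[of 1] by auto
  have not_cong: "\<not> [1 = 0] (mod int p)" "\<not> [i = 0] (mod int p)" "\<not> [- i = 0] (mod int p)"
      "\<not> [j = 0] (mod int p)" "\<not> [- j = 0] (mod int p)"
  proof -
    have "int p dvd 1" if "int p dvd i \<or> int p dvd j"
      using that
    proof
      assume "int p dvd i"
      then show ?thesis using i unfolding cong_iff_dvd_diff by algebra
    next
      assume "int p dvd j"
      then show ?thesis using j unfolding cong_iff_dvd_diff by algebra
    qed
    then have "\<not> int p dvd i" "\<not> int p dvd j"
      using 1 by (auto simp: cong_0_iff)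
    then show "\<not> [1 = 0] (mod int p)" "\<not> [i = 0] (mod int p)" "\<not> [- i = 0] (mod int p)"
        "\<not> [j = 0] (mod int p)" "\<not> [- j = 0] (mod int p)"
      using 1 by (simp_all add: cong_0_iff)
  qed
  have not_cong_1: "\<not> [i = 1] (mod int p)" "\<not> [j = 1] (mod int p)"
  proof -
    have "[l = 1] (mod int p)" if "[i = 1] (mod int p)"
      using that i unfolding cong_iff_dvd_diff by algebra
    then show "\<not> [i = 1] (mod int p)" using ratioD(2)[OF l] by blast
    have "[l = 0] (mod int p)" if "[j = 1] (mod int p)"
      using that j unfolding cong_iff_dvd_diff by algebra
    then show "\<not> [j = 1] (mod int p)" using ratioD(1)[OF l] by blast
  qed
  have mem_iff: "k \<in> ratio_orbit l \<longleftrightarrow> (\<exists>s\<in>?S. [k = s] (mod int p))" if k: "k \<in> ratios" for k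
  proof -
    have nd: "nondegenerate p 1 k" using nondegenerate_ratio[OF k 1] by simp
    have "k \<in> ratio_orbit l \<longleftrightarrow> triple_fun p 1 k \<in> ratio_class l"
      using k by (simp add: ratio_orbit_def triple_fun_1_in_ratio_class_iff)
    \<comment> \<open>In the six orderings, the requirement that the first component be 1 forces
      \<open>w\<close> to be \<open>1\<close>, \<open>i\<close>, \<open>- 1\<close>,
      \<open>- j\<close>, \<open>- i\<close>, \<open>j\<close> respectively, and the second
      component then becomes one of the six listed ratios.\<close>
    also have "\<dots> \<longleftrightarrow> (\<exists>w. \<not> [w = 0] (mod int p) \<and> (\<exists>(x, y) \<in> {(w, w * l), (w * l, w), (- w, w * l - w),
        (w * l - w, - w), (- (w * l), w - w * l), (w - w * l, - (w * l))}.
         [1 = x] (mod int p) \<and> [k = y] (mod int p)))"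
      unfolding ratio_class_def
      using triple_fun_eq_iff[OF p_pos nondegenerate_ratio[OF l] nd] by blast
    also have "\<dots> \<longleftrightarrow> (\<exists>s\<in>?S. [k = s] (mod int p))" (is "?L = ?R")
    proof
      assume ?L
      then obtain w x y where "(x, y) \<in> {(w, w * l), (w * l, w), (- w, w * l - w),
          (w * l - w, - w), (- (w * l), w - w * l), (w - w * l, - (w * l))}"
        and xy: "[1 = x] (mod int p)" "[k = y] (mod int p)"
        by blast
      then consider "x = w" "y = w * l" | "x = w * l" "y = w" | "x = - w" "y = w * l - w"
        | "x = w * l - w" "y = - w" | "x = - (w * l)" "y = w - w * l" | "x = w - w * l" "y = - (w * l)"
        by blast
      then show ?R
      proof cases
        case 1
        have "[k = l] (mod int p)" using xy unfolding 1 cong_iff_dvd_diff by algebra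
        then show ?thesis by blast
      next
        case 2
        have "[k = i] (mod int p)" using xy i unfolding 2 cong_iff_dvd_diff by algebra
        then show ?thesis by blast
      next
        case 3
        have "[k = 1 - l] (mod int p)" using xy unfolding 3 cong_iff_dvd_diff by algebra
        then show ?thesis by blast
      next
        case 4
        have "[k = j] (mod int p)" using xy j unfolding 4 cong_iff_dvd_diff by algebra
        then show ?thesis by blast
      next
        case 5
        have "[k = 1 - i] (mod int p)" using xy i unfolding 5 cong_iff_dvd_diff by algebra
        then show ?thesis by blast
      next
        case 6
        have "[k = 1 - j] (mod int p)" using xy j unfolding 6 cong_iff_dvd_diff by algebra
        then show ?thesis by blast
      qed
    next
      assume ?R
      then consider "[k = l] (mod int p)" | "[k = i] (mod int p)" | "[k = 1 - l] (mod int p)"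
        | "[k = j] (mod int p)" | "[k = 1 - i] (mod int p)" | "[k = 1 - j] (mod int p)"
        by blast
      then show ?L
      proof cases
        case 1
        then show ?thesis using not_cong(1) by (intro exI[of _ 1]) simp
      next
        case 2
        then have "[1 = i * l] (mod int p)" using i unfolding cong_iff_dvd_diff by algebra
        with 2 show ?thesis using not_cong(2) by (intro exI[of _ i]) simp
      next
        case 3
        then have "[k = - 1 * l - - 1] (mod int p)" by simp
        then show ?thesis using not_cong(1) by (intro exI[of _ "- 1"]) (simp add: cong_0_iff)
      next
        case 4
        then have "[1 = - j * l - - j] (mod int p)" using j unfolding cong_iff_dvd_diff by algebra
        with 4 show ?thesis using not_cong(4) by (intro exI[of _ "- j"]) (simp add: cong_0_iff)
      next
        case 5
        then have "[1 = - (- i * l)] (mod int p)" "[k = - i - - i * l] (mod int p)"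
          using i unfolding cong_iff_dvd_diff by algebra+
        then show ?thesis using not_cong(2) by (intro exI[of _ "- i"]) (simp add: cong_0_iff)
      next
        case 6
        then have "[1 = j - j * l] (mod int p)" "[k = - (j * l)] (mod int p)"
          using j unfolding cong_iff_dvd_diff by algebra+
        then show ?thesis using not_cong(4) by (intro exI[of _ j]) simp
      qed
    qed
    finally show ?thesis .
  qed
  have S: "s mod int p \<in> ratios" if "s \<in> ?S" for s
  proof -
    have "\<not> [s = 0] (mod int p)" "\<not> [s = 1] (mod int p)"
      using that not_cong not_cong_1 ratioD(1,2)[OF l] unfolding cong_iff_dvd_diff
      by (auto simp: dvd_diff_commute)
    then show ?thesis by (rule mod_in_ratios)
  qed
  have cong_iff: "[k = s] (mod int p) \<longleftrightarrow> k = s mod int p" if "k \<in> ratios" for k s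
    using ratioD(3)[OF that] by (simp add: cong_def)
  show ?thesis
  proof (intro equalityI subsetI)
    fix k assume k: "k \<in> ratio_orbit l"
    then have kr: "k \<in> ratios" by (simp add: ratio_orbit_def)
    show "k \<in> (\<lambda>x. x mod int p) ` ?S"
      using k unfolding mem_iff[OF kr] cong_iff[OF kr] by blast
  next
    fix k assume "k \<in> (\<lambda>x. x mod int p) ` ?S"
    then obtain s where s: "s \<in> ?S" "k = s mod int p" by blast
    then have kr: "k \<in> ratios" using S by blast
    show "k \<in> ratio_orbit l"
      unfolding mem_iff[OF kr] cong_iff[OF kr] using s by blast
  qed
qed

section \<open>The size of a class by double counting\<close>

lemma finite_ratios: "finite ratios"
  by (simp add: ratios_def)

lemma card_ratios: "card ratios = p - 2"
  by (simp add: ratios_def)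

text \<open>If two of the pairs agreed modulo \<open>p\<close>, a combination of the two coordinate
  differences would show that \<open>p\<close> divides \<open>k * t\<close>, where \<open>k\<close>
  is 1, 2 or 3 and \<open>t\<close> is a nonzero difference of two points of the triple.\<close>

lemma card_six_orderings:
  assumes nd: "nondegenerate p u v"
  shows "card ((\<lambda>(x, y). (x mod int p, y mod int p)) `
    {(u, v), (v, u), (- u, v - u), (v - u, - u), (- v, u - v), (u - v, - v)}) = 6"
proof -
  let ?f = "\<lambda>(x, y). (x mod int p, y mod int p)"
  let ?xs = "[(u, v), (v, u), (- u, v - u), (v - u, - u), (- v, u - v), (u - v, - v)]"
  have neq: "(x mod int p, y mod int p) \<noteq> (x' mod int p, y' mod int p)"
    if "\<alpha> * (x - x') + \<beta> * (y - y') = k * t" "k \<in> {1, 2, 3}" "t \<in> {u, v, u - v}"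
    for x y x' y' \<alpha> \<beta> k t
  proof
    assume "(x mod int p, y mod int p) = (x' mod int p, y' mod int p)"
    then have "int p dvd x - x'" "int p dvd y - y'"
      by (simp_all add: mod_eq_dvd_iff)
    then have "int p dvd \<alpha> * (x - x') + \<beta> * (y - y')" by simp
    then have "[k * t = 0] (mod int p)" using that(1) by (simp add: cong_0_iff)
    moreover have "\<not> [k = 0] (mod int p)" using that(2) small_not_cong_0[of k] by auto
    moreover have "\<not> [t = 0] (mod int p)"
      using that(3) nd by (auto simp: nondegenerate_def cong_diff_iff_cong_0)
    ultimately show False by (simp add: cong_mult_eq_0_iff)
  qed
  have "distinct (map ?f ?xs)"
    \<comment> \<open>One instance for each of the fifteen pairs of orderings; the coefficients
      \<open>\<alpha>\<close> and \<open>\<beta>\<close> are chosen so that the combination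
      collapses to \<open>k * t\<close>.\<close>
    using neq[of 1 u v 0 v u 1 "u - v"] neq[of 1 u "- u" 0 v "v - u" 2 u]
      neq[of 1 u "v - u" 1 v "- u" 3 u] neq[of 1 u "- v" 1 v "u - v" 3 v]
      neq[of 1 u "u - v" 0 v "- v" 1 v]
      neq[of 1 v "- u" 1 u "v - u" 3 u] neq[of 1 v "v - u" 0 u "- u" 1 u]
      neq[of 1 v "- v" 0 u "u - v" 2 v] neq[of 1 v "u - v" 1 u "- v" 3 v]
      neq[of "-1" "- u" "v - u" 0 "v - u" "- u" 1 v] neq[of "-1" "- u" "- v" 0 "v - u" "u - v" 1 "u - v"]
      neq[of "-2" "- u" "u - v" 1 "v - u" "- v" 3 u]
      neq[of 1 "v - u" "- v" "-2" "- u" "u - v" 3 u] neq[of 0 "v - u" "u - v" "-1" "- u" "- v" 1 "u - v"]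
      neq[of "-1" "- v" "u - v" 0 "u - v" "- v" 1 u]
    by simp
  from distinct_card[OF this] show ?thesis by simp
qed

text \<open>Every function arises from the six orderings of a triple, so both sides count the
  pairs \<open>(u, v)\<close> whose function lies in the class.\<close>

lemma card_ratio_class:
  assumes l: "l \<in> ratios"
  shows "6 * card (ratio_class l) = (p - 1) * card (ratio_orbit l)"
proof -
  let ?F = "\<lambda>(u, v). triple_fun p u v"
  let ?m = "\<lambda>(x, y). (x mod int p, y mod int p)"
  define K where "K = {(u, v). u \<in> {0..<int p} \<and> v \<in> {0..<int p} \<and> nondegenerate p u v \<and>
    triple_fun p u v \<in> ratio_class l}"
  have finK: "finite K"
    by (rule finite_subset[of _ "{0..<int p} \<times> {0..<int p}"]) (auto simp: K_def)
  have cong_mod: "[x mod int p = x] (mod int p)" for x by (simp add: cong_def)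
  have mod_in: "x mod int p \<in> {0..<int p}" for x using p_pos by simp
  have nd_mod: "nondegenerate p (x mod int p) (y mod int p) \<longleftrightarrow> nondegenerate p x y" for x y
    unfolding nondegenerate_def by (simp add: cong_def)
  have F_mod: "triple_fun p (x mod int p) (y mod int p) = triple_fun p x y" for x y
    by (intro triple_fun_cong p_pos cong_mod)
  have mem_orbit: "k \<in> ratio_orbit l" if "k \<in> ratios" "[v = u * k] (mod int p)"
    "\<not> [u = 0] (mod int p)" "triple_fun p u v \<in> ratio_class l" for k u v
    using that ratio_class_eqI[OF that(3,2)] ratio_class_of_member[OF that(4)]
    by (simp add: ratio_orbit_def)
  \<comment> \<open>One way to count \<open>K\<close>: a pair is a nonzero first difference together
    with a ratio from the orbit, chosen independently.\<close>
  have "bij_betw (\<lambda>(w, k). (w, w * k mod int p)) ({1..<int p} \<times> ratio_orbit l) K"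
  proof (rule bij_betw_imageI)
    show "inj_on (\<lambda>(w, k). (w, w * k mod int p)) ({1..<int p} \<times> ratio_orbit l)"
    proof (rule inj_onI)
      fix x y assume "x \<in> {1..<int p} \<times> ratio_orbit l" "y \<in> {1..<int p} \<times> ratio_orbit l"
        and "(\<lambda>(w, k). (w, w * k mod int p)) x = (\<lambda>(w, k). (w, w * k mod int p)) y"
      then obtain w k k' where xy: "x = (w, k)" "y = (w, k')"
        and w: "w \<in> {1..<int p}" and k: "k \<in> ratio_orbit l" "k' \<in> ratio_orbit l"
        and eq: "w * k mod int p = w * k' mod int p"
        by (cases x; cases y) simp
      have "\<not> [w = 0] (mod int p)"
        using w cong_small_imp_eq[of w 0 "int p"] by auto
      then have "[k = k'] (mod int p)"
        using eq cong_mult_lcancel[of w "int p"] coprime_iff_not_cong_0 unfolding cong_def[symmetric]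
        by blast
      then show "x = y"
        using k ratioD(3) by (simp add: cong_def ratio_orbit_def xy)
    qed
    show "(\<lambda>(w, k). (w, w * k mod int p)) ` ({1..<int p} \<times> ratio_orbit l) = K"
    proof (intro equalityI subsetI)
      fix z assume "z \<in> (\<lambda>(w, k). (w, w * k mod int p)) ` ({1..<int p} \<times> ratio_orbit l)"
      then obtain w k where z: "z = (w, w * k mod int p)"
        and w: "w \<in> {1..<int p}" and k: "k \<in> ratio_orbit l"
        by auto
      have w0: "\<not> [w = 0] (mod int p)"
        using w cong_small_imp_eq[of w 0 "int p"] by auto
      have wmod: "w mod int p = w" using w by simp
      have "nondegenerate p w (w * k)"
        using k w0 by (intro nondegenerate_ratio) (simp_all add: ratio_orbit_def)
      moreover have "triple_fun p w (w * k) \<in> ratio_class l"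
        using k w0 unfolding ratio_orbit_def ratio_class_def by blast
      ultimately show "z \<in> K"
        using w mod_in nd_mod[of w "w * k"] F_mod[of w "w * k"] unfolding K_def wmod z by simp
    next
      fix z assume z: "z \<in> K"
      obtain u v where zuv: "z = (u, v)" by (cases z)
      then have uv: "u \<in> {0..<int p}" "v \<in> {0..<int p}" "nondegenerate p u v"
        "triple_fun p u v \<in> ratio_class l"
        using z by (auto simp: K_def)
      obtain k where k: "k \<in> ratios" "[v = u * k] (mod int p)" using uv(3) by (rule obtain_ratio)
      have u0: "\<not> [u = 0] (mod int p)" using uv(3) by (simp add: nondegenerate_def)
      then have "u \<noteq> 0" by auto
      then have "u \<in> {1..<int p}" using uv(1) by auto
      moreover have "k \<in> ratio_orbit l" using mem_orbit k u0 uv(4) by blast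
      moreover have "v = u * k mod int p" using k(2) uv(2) by (simp add: cong_def)
      ultimately show "z \<in> (\<lambda>(w, k). (w, w * k mod int p)) ` ({1..<int p} \<times> ratio_orbit l)"
        unfolding zuv by (intro rev_image_eqI[of "(u, k)"]) simp_all
    qed
  qed
  then have "card K = card ({1..<int p} \<times> ratio_orbit l)"
    by (rule bij_betw_same_card[symmetric])
  then have card_K: "card K = (p - 1) * card (ratio_orbit l)"
    using p_pos by (simp add: card_cartesian_product nat_diff_distrib)
  have img: "?F ` K = ratio_class l"
  proof (intro equalityI subsetI)
    fix f assume f: "f \<in> ratio_class l"
    then obtain w where w: "\<not> [w = 0] (mod int p)" "f = triple_fun p w (w * l)"
      unfolding ratio_class_def by blast
    have "(w mod int p, w * l mod int p) \<in> K"
      using mod_in nd_mod F_mod nondegenerate_ratio[OF l w(1)] f w(2) unfolding K_def by simp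
    then show "f \<in> ?F ` K"
      by (rule rev_image_eqI) (simp add: F_mod w(2))
  qed (auto simp: K_def)
  \<comment> \<open>The other way: every function of the class comes from exactly six reduced
    pairs.\<close>
  have fibre: "card {x \<in> K. ?F x = f} = 6" if f_in: "f \<in> ?F ` K" for f
  proof -
    obtain z where z: "z \<in> K" "f = ?F z" using f_in by blast
    obtain u v where "z = (u, v)" by (cases z)
    then have uv: "(u, v) \<in> K" and f: "f = triple_fun p u v" using z by simp_all
    have nd: "nondegenerate p u v" and mem: "triple_fun p u v \<in> ratio_class l"
      using uv by (auto simp: K_def)
    let ?P = "{(u, v), (v, u), (- u, v - u), (v - u, - u), (- v, u - v), (u - v, - v)}"
    have ndP: "nondegenerate p x y" if "(x, y) \<in> ?P" for x y
      using that nd unfolding nondegenerate_def cong_iff_dvd_diff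
      by (auto simp: dvd_diff_commute)
    have "{x \<in> K. ?F x = f} = ?m ` ?P"
    proof (intro equalityI subsetI)
      fix z assume "z \<in> {x \<in> K. ?F x = f}"
      then obtain x y where z: "z = (x, y)" and xy: "(x, y) \<in> K" "f = triple_fun p x y"
        by (cases z) auto
      then have ndxy: "nondegenerate p x y" and r: "x mod int p = x" "y mod int p = y"
        by (auto simp: K_def)
      obtain x' y' where "(x', y') \<in> ?P" "[x = x'] (mod int p)" "[y = y'] (mod int p)"
        using triple_fun_eq_iff[OF p_pos nd ndxy] xy(2) f by blast
      then have "(x', y') \<in> ?P" "(x, y) = ?m (x', y')"
        using r by (simp_all add: cong_def)
      then show "z \<in> ?m ` ?P" unfolding z by (rule rev_image_eqI)
    next
      fix z assume "z \<in> ?m ` ?P"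
      then obtain q where q: "q \<in> ?P" "z = ?m q" by (rule imageE)
      obtain x y where "q = (x, y)" by (cases q)
      then have xy: "(x, y) \<in> ?P" and z: "z = (x mod int p, y mod int p)" using q by simp_all
      have "triple_fun p x y = triple_fun p u v"
        using triple_fun_eq_iff[OF p_pos nd ndP[OF xy]] xy cong_refl by blast
      then show "z \<in> {x \<in> K. ?F x = f}"
        unfolding z using ndP[OF xy] mem mod_in by (simp add: K_def nd_mod F_mod f)
    qed
    then show ?thesis using card_six_orderings[OF nd] by simp
  qed
  have "card K = (\<Sum>f\<in>?F ` K. card {x \<in> K. ?F x = f})"
    using sum.image_gen[OF finK, of "\<lambda>_. 1::nat" ?F] by simp
  also have "\<dots> = 6 * card (ratio_class l)"
    using fibre img by simp
  finally show ?thesis using card_K by simp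
qed

section \<open>Special and generic ratios\<close>

lemma two_in_ratios: "2 \<in> ratios"
  using p_gt_3 by (simp add: ratios_def)

lemma cong_eq_mod: "l \<in> ratios \<Longrightarrow> [l = x] (mod int p) \<Longrightarrow> l = x mod int p"
  using ratioD(3)[of l] by (simp add: cong_def)

text \<open>For \<open>l = 2\<close> the inverses are \<open>i = h\<close> and
  \<open>j = - 1\<close>, and the six values coincide in pairs: \<open>1 - 2 = - 1\<close>,
  \<open>1 - h = h\<close> and \<open>1 - (- 1) = 2\<close>.\<close>

lemma ratio_orbit_2:
  assumes h: "[2 * h = 1] (mod int p)"
  shows "ratio_orbit 2 = (\<lambda>x. x mod int p) ` {2, h, - 1}"
proof -
  have "[1 - h = h] (mod int p)"
    using h unfolding cong_iff_dvd_diff by algebra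
  then have "(1 - h) mod int p = h mod int p" by (simp add: cong_def)
  moreover have "ratio_orbit 2 = (\<lambda>x. x mod int p) ` {2, h, 1 - 2, - 1, 1 - h, 1 - - 1}"
    by (rule ratio_orbit_eq[OF two_in_ratios h]) simp
  ultimately show ?thesis by auto
qed

lemma obtain_half:
  obtains h where "[2 * h = 1] (mod int p)"
  using obtain_inverse[of 2] small_not_cong_0[of 2] by auto

text \<open>\<open>2 * (2 - h)\<close> and \<open>2 * (h + 1)\<close> are both 3 modulo
  \<open>p\<close>, and so is \<open>2 - (- 1)\<close>; a coincidence would make \<open>p\<close>
  divide 3.\<close>

lemma card_ratio_orbit_2: "card (ratio_orbit 2) = 3"
proof -
  obtain h where h: "[2 * h = 1] (mod int p)" by (rule obtain_half)
  have no3: "\<not> int p dvd 3" using small_not_cong_0[of 3] by (auto simp: cong_0_iff)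
  have neq: "x mod int p \<noteq> y mod int p" if "int p dvd x - y \<Longrightarrow> int p dvd 3" for x y
    using that no3 by (auto simp: mod_eq_dvd_iff)
  have "2 mod int p \<noteq> h mod int p"
    by (rule neq) (use h in \<open>unfold cong_iff_dvd_diff, algebra\<close>)
  moreover have "h mod int p \<noteq> - 1 mod int p"
    by (rule neq) (use h in \<open>unfold cong_iff_dvd_diff, algebra\<close>)
  moreover have "2 mod int p \<noteq> - 1 mod int p"
    by (rule neq) simp
  ultimately have "distinct (map (\<lambda>x. x mod int p) [2, h, - 1])"
    by simp
  from distinct_card[OF this] show ?thesis
    by (simp add: ratio_orbit_2[OF h])
qed

text \<open>The three conditions say that \<open>l\<close> is \<open>- 1\<close>, 2 or one half, the
  orbit of 2. These are the triples in arithmetic progression.\<close>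

lemma ratio_class_eq_2:
  assumes l: "l \<in> ratios"
    and special: "[l + 1 = 0] (mod int p) \<or> [l - 2 = 0] (mod int p) \<or> [2 * l - 1 = 0] (mod int p)"
  shows "ratio_class l = ratio_class 2"
proof -
  obtain h where h: "[2 * h = 1] (mod int p)" by (rule obtain_half)
  have "\<exists>x\<in>{2, h, - 1}. [l = x] (mod int p)"
    using special
  proof (elim disjE)
    assume "[l + 1 = 0] (mod int p)"
    then have "[l = - 1] (mod int p)" by (simp add: cong_iff_dvd_diff)
    then show ?thesis by blast
  next
    assume "[l - 2 = 0] (mod int p)"
    then have "[l = 2] (mod int p)" by (simp add: cong_iff_dvd_diff)
    then show ?thesis by blast
  next
    assume "[2 * l - 1 = 0] (mod int p)"
    then have "int p dvd h * (2 * l - 1) - l * (2 * h - 1)"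
      using h by (simp add: cong_iff_dvd_diff)
    then have "[l = h] (mod int p)" by (simp add: cong_iff_dvd_diff algebra_simps)
    then show ?thesis by blast
  qed
  then have "l \<in> ratio_orbit 2"
    unfolding ratio_orbit_2[OF h] using cong_eq_mod[OF l] by blast
  then show ?thesis by (simp add: ratio_orbit_def)
qed

text \<open>The equation says \<open>l * (1 - l) = 1\<close>, so \<open>i = 1 - l\<close> and
  \<open>j = l\<close>, and only two of the six values remain. Such \<open>l\<close> are the
  primitive sixth roots of unity.\<close>

lemma ratio_orbit_root:
  assumes l: "l \<in> ratios" and root: "[l * l - l + 1 = 0] (mod int p)"
  shows "ratio_orbit l = (\<lambda>x. x mod int p) ` {l, 1 - l}"
proof -
  have "[l * (1 - l) = 1] (mod int p)" "[(1 - l) * l = 1] (mod int p)"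
    using root unfolding cong_iff_dvd_diff by algebra+
  from ratio_orbit_eq[OF l this] show ?thesis by auto
qed

text \<open>Four times \<open>l * l - l + 1\<close> is the square of \<open>2 * l - 1\<close> plus
  3, so \<open>l = 1 - l\<close> would make \<open>p\<close> divide 3.\<close>

lemma card_ratio_orbit_root:
  assumes l: "l \<in> ratios" and root: "[l * l - l + 1 = 0] (mod int p)"
  shows "card (ratio_orbit l) = 2"
proof -
  have "int p dvd 3" if "int p dvd l - (1 - l)"
    using that root unfolding cong_iff_dvd_diff by algebra
  then have "\<not> int p dvd l - (1 - l)" using small_not_cong_0[of 3] by (auto simp: cong_0_iff)
  then have "l mod int p \<noteq> (1 - l) mod int p"
    by (simp only: mod_eq_dvd_iff not_False_eq_True)
  then show ?thesis by (simp add: ratio_orbit_root[OF assms])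
qed

text \<open>The difference of the two quadratic values factors as
  \<open>(k - l) * (k - (1 - l))\<close>, so \<open>k\<close> is one of the two elements of the
  orbit of \<open>l\<close>.\<close>

lemma ratio_class_eq_root:
  assumes l: "l \<in> ratios" "[l * l - l + 1 = 0] (mod int p)"
    and k: "k \<in> ratios" "[k * k - k + 1 = 0] (mod int p)"
  shows "ratio_class k = ratio_class l"
proof -
  have "[(k - l) * (k - (1 - l)) = 0] (mod int p)"
    using l(2) k(2) unfolding cong_iff_dvd_diff by algebra
  then have "[k = l] (mod int p) \<or> [k = 1 - l] (mod int p)"
    by (simp only: cong_mult_eq_0_iff cong_diff_iff_cong_0)
  then have "k \<in> ratio_orbit l"
    unfolding ratio_orbit_root[OF l] using cong_eq_mod[OF k(1)] by blast
  then show ?thesis by (simp add: ratio_orbit_def)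
qed

text \<open>The six ratios are the values at \<open>l\<close> of the group of substitutions
  generated by \<open>x \<mapsto> 1 / x\<close> and \<open>x \<mapsto> 1 - x\<close>. Two values
  agree only if a nontrivial substitution fixes \<open>l\<close>. Apart from 0 and 1, the three
  involutions fix \<open>- 1\<close>, one half and 2, and the two elements of order 3 fix the roots
  of \<open>l * l - l + 1\<close>.\<close>

lemma card_ratio_orbit_generic:
  assumes l: "l \<in> ratios"
    and generic: "\<not> [l + 1 = 0] (mod int p)" "\<not> [l - 2 = 0] (mod int p)"
      "\<not> [2 * l - 1 = 0] (mod int p)" "\<not> [l * l - l + 1 = 0] (mod int p)"
  shows "card (ratio_orbit l) = 6"
proof -
  have l1: "\<not> [1 - l = 0] (mod int p)" "\<not> [l = 0] (mod int p)" "\<not> [1 = 0] (mod int p)"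
    using ratioD(1,2)[OF l] small_not_cong_0[of 1] by (auto simp: cong_iff_dvd_diff dvd_diff_commute)
  obtain i where i: "[l * i = 1] (mod int p)" using l1(2) by (rule obtain_inverse)
  obtain j where j: "[(1 - l) * j = 1] (mod int p)" using l1(1) by (rule obtain_inverse)
  \<comment> \<open>Multiplying by \<open>l (1 - l)\<close> turns a coincidence of two of the six ratios into a polynomial
    relation for \<open>l\<close>.\<close>
  have neq: "x mod int p \<noteq> y mod int p"
    if "x - y = a + b * i + c * j" and "l * (1 - l) * a + b * (1 - l) + c * l = f * g * h"
      and nz: "\<not> [f = 0] (mod int p)" "\<not> [g = 0] (mod int p)" "\<not> [h = 0] (mod int p)"
    for x y a b c f g h
  proof
    assume "x mod int p = y mod int p"
    then have "int p dvd a + b * i + c * j"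
      using that(1) by (simp add: mod_eq_dvd_iff)
    then have "int p dvd l * (1 - l) * a + b * (1 - l) + c * l"
      using i j unfolding cong_iff_dvd_diff by algebra
    then have "[f * g * h = 0] (mod int p)" using that(2) by (simp add: cong_0_iff)
    then show False using nz by (simp add: cong_mult_eq_0_iff)
  qed
  have minus: "\<not> [- x = 0] (mod int p)" if "\<not> [x = 0] (mod int p)" for x
    using that by (simp add: cong_0_iff)
  note nz = generic l1 minus[OF l1(3)] minus[OF l1(1)]
  let ?A = "l + 1" and ?B = "l - 2" and ?C = "2 * l - 1" and ?D = "l * l - l + 1"
  \<comment> \<open>In each instance the first three terms are the coefficients of the difference
    with respect to \<open>1\<close>, \<open>i\<close>, \<open>j\<close>; the last three are the
    nonzero factors of the resulting polynomial.\<close>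
  have "l mod int p \<noteq> i mod int p"
    by (rule neq[of _ _ "l" "- 1" "0" "- (1 - l)" "1 - l" "?A"])
      (use nz in \<open>simp_all add: algebra_simps cong_mult_eq_0_iff\<close>)
  moreover have "l mod int p \<noteq> (1 - l) mod int p"
    by (rule neq[of _ _ "?C" "0" "0" "?C" "l" "1 - l"])
      (use nz in \<open>simp_all add: algebra_simps cong_mult_eq_0_iff\<close>)
  moreover have "l mod int p \<noteq> j mod int p"
    by (rule neq[of _ _ "l" "0" "- 1" "- 1" "l" "?D"])
      (use nz in \<open>simp_all add: algebra_simps cong_mult_eq_0_iff\<close>)
  moreover have "l mod int p \<noteq> (1 - i) mod int p"
    by (rule neq[of _ _ "l - 1" "1" "0" "1 - l" "1" "?D"])
      (use nz in \<open>simp_all add: algebra_simps cong_mult_eq_0_iff\<close>)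
  moreover have "l mod int p \<noteq> (1 - j) mod int p"
    by (rule neq[of _ _ "l - 1" "0" "1" "- 1" "l * l" "?B"])
      (use nz in \<open>simp_all add: algebra_simps cong_mult_eq_0_iff\<close>)
  moreover have "i mod int p \<noteq> (1 - l) mod int p"
    by (rule neq[of _ _ "l - 1" "1" "0" "1 - l" "1" "?D"])
      (use nz in \<open>simp_all add: algebra_simps cong_mult_eq_0_iff\<close>)
  moreover have "i mod int p \<noteq> j mod int p"
    by (rule neq[of _ _ "0" "1" "- 1" "- 1" "1" "?C"])
      (use nz in \<open>simp_all add: algebra_simps cong_mult_eq_0_iff\<close>)
  moreover have "i mod int p \<noteq> (1 - i) mod int p"
    by (rule neq[of _ _ "- 1" "2" "0" "1 - l" "- 1" "?B"])
      (use nz in \<open>simp_all add: algebra_simps cong_mult_eq_0_iff\<close>)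
  moreover have "i mod int p \<noteq> (1 - j) mod int p"
    by (rule neq[of _ _ "- 1" "1" "1" "1" "1" "?D"])
      (use nz in \<open>simp_all add: algebra_simps cong_mult_eq_0_iff\<close>)
  moreover have "(1 - l) mod int p \<noteq> j mod int p"
    by (rule neq[of _ _ "1 - l" "0" "- 1" "l * l" "1" "?B"])
      (use nz in \<open>simp_all add: algebra_simps cong_mult_eq_0_iff\<close>)
  moreover have "(1 - l) mod int p \<noteq> (1 - i) mod int p"
    by (rule neq[of _ _ "- l" "1" "0" "1 - l" "1 - l" "?A"])
      (use nz in \<open>simp_all add: algebra_simps cong_mult_eq_0_iff\<close>)
  moreover have "(1 - l) mod int p \<noteq> (1 - j) mod int p"
    by (rule neq[of _ _ "- l" "0" "1" "l" "1" "?D"])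
      (use nz in \<open>simp_all add: algebra_simps cong_mult_eq_0_iff\<close>)
  moreover have "j mod int p \<noteq> (1 - i) mod int p"
    by (rule neq[of _ _ "- 1" "1" "1" "1" "1" "?D"])
      (use nz in \<open>simp_all add: algebra_simps cong_mult_eq_0_iff\<close>)
  moreover have "j mod int p \<noteq> (1 - j) mod int p"
    by (rule neq[of _ _ "- 1" "0" "2" "l" "1" "?A"])
      (use nz in \<open>simp_all add: algebra_simps cong_mult_eq_0_iff\<close>)
  moreover have "(1 - i) mod int p \<noteq> (1 - j) mod int p"
    by (rule neq[of _ _ "0" "- 1" "1" "1" "1" "?C"])
      (use nz in \<open>simp_all add: algebra_simps cong_mult_eq_0_iff\<close>)
  ultimately have "distinct (map (\<lambda>x. x mod int p) [l, i, 1 - l, j, 1 - i, 1 - j])"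
    by simp
  from distinct_card[OF this] show ?thesis by (simp add: ratio_orbit_eq[OF l i j])
qed

lemma ratio_class_cases:
  assumes l: "l \<in> ratios"
  obtains "ratio_class l = ratio_class 2" "card (ratio_orbit l) = 3"
    | "[l * l - l + 1 = 0] (mod int p)" "card (ratio_orbit l) = 2"
    | "card (ratio_orbit l) = 6"
proof (cases "[l * l - l + 1 = 0] (mod int p)")
  case True
  then show thesis using that(2) card_ratio_orbit_root[OF l] by blast
next
  case not_root: False
  show thesis
  proof (cases "[l + 1 = 0] (mod int p) \<or> [l - 2 = 0] (mod int p) \<or> [2 * l - 1 = 0] (mod int p)")
    case True
    then have "ratio_class l = ratio_class 2" by (rule ratio_class_eq_2[OF l])
    then show thesis using that(1) card_ratio_orbit_2 by (simp add: ratio_orbit_def)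
  next
    case False
    then show thesis using that(3) card_ratio_orbit_generic[OF l] not_root by blast
  qed
qed

section \<open>Classes sorted by size, and the count of ratios\<close>

lemma finite_mrs_classes: "finite (mrs_classes p)"
  by (simp add: mrs_classes_eq finite_ratios)

text \<open>Stated by multiplication instead of \<open>div\<close>, so that the condition is exact
  also when 3 does not divide \<open>p - 1\<close>.\<close>

definition third_classes :: "anf set set" where
  "third_classes = {C \<in> mrs_classes p. 3 * card C = p - 1}"

definition full_classes :: "anf set set" where
  "full_classes = {C \<in> mrs_classes p. card C = p - 1}"

text \<open>Orbits of 3, 2 and 6 ratios correspond to sizes \<open>(p - 1) / 2\<close>,
  \<open>(p - 1) / 3\<close> and \<open>p - 1\<close>, since six times the size is
  \<open>p - 1\<close> times the number of ratios.\<close>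

lemma ratio_class_size_cases:
  assumes l: "l \<in> ratios"
  shows "ratio_class l = ratio_class 2 \<and> 2 * card (ratio_class l) = p - 1 \<and> card (ratio_orbit l) = 3 \<or>
    ratio_class l \<in> third_classes \<and> [l * l - l + 1 = 0] (mod int p) \<and> card (ratio_orbit l) = 2 \<or>
    ratio_class l \<in> full_classes \<and> card (ratio_orbit l) = 6"
proof -
  have C: "ratio_class l \<in> mrs_classes p" using l by (simp add: mrs_classes_eq)
  from l show ?thesis
    by (cases rule: ratio_class_cases)
      (use card_ratio_class[OF l] C in \<open>simp_all add: third_classes_def full_classes_def\<close>)
qed

lemma half_class: "ratio_class 2 \<in> mrs_classes p" "2 * card (ratio_class 2) = p - 1"
  using two_in_ratios card_ratio_class[OF two_in_ratios] card_ratio_orbit_2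
  by (simp_all add: mrs_classes_eq)

lemma mrs_classes_cases: "mrs_classes p = insert (ratio_class 2) (third_classes \<union> full_classes)"
  using ratio_class_size_cases half_class(1)
  by (auto simp: mrs_classes_eq third_classes_def full_classes_def)

lemma mrs_classes_disjoint:
  "ratio_class 2 \<notin> third_classes" "ratio_class 2 \<notin> full_classes" "third_classes \<inter> full_classes = {}"
  using half_class(2) p_gt_3 by (auto simp: third_classes_def full_classes_def)

lemma third_class_ratio:
  assumes "l \<in> ratios" "ratio_class l \<in> third_classes"
  shows "[l * l - l + 1 = 0] (mod int p)" "card (ratio_orbit l) = 2"
proof -
  have "ratio_class l \<noteq> ratio_class 2"
    using assms(2) mrs_classes_disjoint(1) by metis
  moreover have "ratio_class l \<notin> full_classes"
    using assms(2) mrs_classes_disjoint(3) by blast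
  ultimately show "[l * l - l + 1 = 0] (mod int p)" "card (ratio_orbit l) = 2"
    using ratio_class_size_cases[OF assms(1)] by blast+
qed

lemma full_class_ratio:
  assumes "l \<in> ratios" "ratio_class l \<in> full_classes"
  shows "card (ratio_orbit l) = 6"
proof -
  have "ratio_class l \<noteq> ratio_class 2"
    using assms(2) mrs_classes_disjoint(2) by metis
  moreover have "ratio_class l \<notin> third_classes"
    using assms(2) mrs_classes_disjoint(3) by blast
  ultimately show ?thesis
    using ratio_class_size_cases[OF assms(1)] by blast
qed

lemma card_third_classes: "card third_classes \<le> 1"
proof -
  have "C = D" if CD: "C \<in> third_classes" "D \<in> third_classes" for C D
  proof -
    obtain l k where lk: "l \<in> ratios" "C = ratio_class l" "k \<in> ratios" "D = ratio_class k"
      using CD by (auto simp: third_classes_def mrs_classes_eq)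
    have "[l * l - l + 1 = 0] (mod int p)"
      using CD(1) unfolding lk(2) by (rule third_class_ratio(1)[OF lk(1)])
    moreover have "[k * k - k + 1 = 0] (mod int p)"
      using CD(2) unfolding lk(4) by (rule third_class_ratio(1)[OF lk(3)])
    ultimately show ?thesis
      unfolding lk(2,4) using ratio_class_eq_root lk(1,3) by blast
  qed
  then show ?thesis
    using card_le_Suc0_iff_eq[of third_classes] finite_mrs_classes
    by (auto simp: third_classes_def)
qed

lemma finite_classes: "finite third_classes" "finite full_classes"
  using finite_mrs_classes by (simp_all add: third_classes_def full_classes_def)

lemma num_classes_eq: "num_classes p = 1 + card third_classes + card full_classes"
  using mrs_classes_disjoint finite_classes
  by (simp add: num_classes_def mrs_classes_cases card_Un_disjoint)

text \<open>Counting ratios class by class determines the number of classes of each size; in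
  particular, the residue of \<open>p\<close> modulo 6 decides whether \<open>l\<^sup>2 - l + 1\<close> has a root.\<close>

lemma p_eq: "p = 5 + 2 * card third_classes + 6 * card full_classes"
proof -
  let ?o = "\<lambda>C. card {k \<in> ratios. ratio_class k = C}"
  have o: "?o (ratio_class l) = card (ratio_orbit l)" for l
    by (simp add: ratio_orbit_def)
  have "p - 2 = (\<Sum>C\<in>mrs_classes p. ?o C)"
    using sum.image_gen[OF finite_ratios, of "\<lambda>_. 1::nat" ratio_class]
    by (simp add: mrs_classes_eq card_ratios)
  also have "\<dots> = ?o (ratio_class 2) + ((\<Sum>C\<in>third_classes. ?o C) + (\<Sum>C\<in>full_classes. ?o C))"
    using mrs_classes_disjoint finite_classes
    by (simp add: mrs_classes_cases sum.union_disjoint)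
  also have "?o (ratio_class 2) = 3"
    unfolding o by (rule card_ratio_orbit_2)
  also have "(\<Sum>C\<in>third_classes. ?o C) = (\<Sum>C\<in>third_classes. 2)"
  proof (rule sum.cong)
    fix C assume C: "C \<in> third_classes"
    then obtain l where l: "l \<in> ratios" "C = ratio_class l"
      by (auto simp: third_classes_def mrs_classes_eq)
    then show "?o C = 2"
      using third_class_ratio(2) C unfolding l(2) o by blast
  qed simp
  also have "(\<Sum>C\<in>full_classes. ?o C) = (\<Sum>C\<in>full_classes. 6)"
  proof (rule sum.cong)
    fix C assume C: "C \<in> full_classes"
    then obtain l where l: "l \<in> ratios" "C = ratio_class l"
      by (auto simp: full_classes_def mrs_classes_eq)
    then show "?o C = 6"
      using full_class_ratio C unfolding l(2) o by blast
  qed simp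
  finally show ?thesis using p_gt_3 by simp
qed

text \<open>The differences of \<open>(1, 2, 3)\<close> are 1 and 2, so its ratio is 2.\<close>

lemma mrs_1_2_3_mem_iff:
  assumes "C \<in> mrs_classes p"
  shows "mrs p 1 2 3 \<in> C \<longleftrightarrow> C = ratio_class 2"
proof -
  obtain l where l: "C = ratio_class l" using assms by (auto simp: mrs_classes_eq)
  have "nondegenerate p (int 2 - int 1) (int 3 - int 1)"
    using nondegenerate_ratio[OF two_in_ratios, of 1] small_not_cong_0[of 1] by auto
  from mrs_eq_triple_fun[OF p_pos this] have "mrs p 1 2 3 = triple_fun p 1 2" by simp
  then show ?thesis unfolding l by (auto simp: triple_fun_1_in_ratio_class_iff)
qed

text \<open>The size of the class of ratio 2 shows that \<open>p - 1\<close> is even, so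
  \<open>div 2\<close> is exact; the three sizes exclude each other because \<open>p - 1\<close> is
  positive.\<close>

lemma card_class_iff:
  assumes "C \<in> mrs_classes p"
  shows "card C = (p - 1) div 2 \<longleftrightarrow> C = ratio_class 2"
    and "3 * card C = p - 1 \<longleftrightarrow> C \<in> third_classes"
    and "card C = p - 1 \<longleftrightarrow> C \<in> full_classes"
proof -
  show third: "3 * card C = p - 1 \<longleftrightarrow> C \<in> third_classes"
    and full: "card C = p - 1 \<longleftrightarrow> C \<in> full_classes"
    using assms by (simp_all add: third_classes_def full_classes_def)
  show "card C = (p - 1) div 2 \<longleftrightarrow> C = ratio_class 2"
  proof
    assume half: "card C = (p - 1) div 2"
    then have "2 * card C = p - 1" using half_class(2) by presburger
    then have "C \<notin> third_classes \<union> full_classes"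
      using p_gt_3 by (auto simp: third[symmetric] full[symmetric])
    then show "C = ratio_class 2" using assms mrs_classes_cases by blast
  qed (use half_class(2) in presburger)
qed

end

section \<open>The case \<open>p = 3\<close> and the final statement\<close>

lemma num_classes_3: "num_classes 3 = 1"
proof -
  \<comment> \<open>All three shifts give the one monomial in three variables, so both choices of
    \<open>j\<close> and \<open>k\<close> yield the same function.\<close>
  have "mrs 3 1 3 2 = mrs 3 1 2 3"
    by (simp add: mrs_def mult_ac)
  moreover have "{1..3::nat} = {1, 2, 3}" by auto
  then have "cubic_mrs 3 \<subseteq> {mrs 3 1 2 3, mrs 3 1 3 2}"
    unfolding cubic_mrs_def by auto
  moreover have "mrs 3 1 2 3 \<in> cubic_mrs 3"
    unfolding cubic_mrs_def by (intro CollectI exI[of _ 2] exI[of _ 3]) simp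
  ultimately have "cubic_mrs 3 = {mrs 3 1 2 3}" by auto
  then show ?thesis by (simp add: num_classes_def mrs_classes_def quotient_def)
qed

theorem theorem4p2:
  fixes p :: nat
  assumes "prime p" and "p \<ge> 3"
  shows "num_classes p = p div 6 + 1 \<and>
    (p > 5 \<longrightarrow>
       (\<exists>!C. C \<in> mrs_classes p \<and> card C = (p - 1) div 2) \<and>
       (\<forall>C\<in>mrs_classes p. card C = (p - 1) div 2 \<longleftrightarrow> mrs p 1 2 3 \<in> C) \<and>
       (p mod 6 = 1 \<longrightarrow>
          (\<exists>!C. C \<in> mrs_classes p \<and> card C = (p - 1) div 3)) \<and>
       (p mod 6 = 1 \<longrightarrow>
          (\<forall>C\<in>mrs_classes p. card C \<notin> {(p - 1) div 2, (p - 1) div 3} \<longrightarrow> card C = p - 1) \<and>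
          card {C \<in> mrs_classes p. card C \<notin> {(p - 1) div 2, (p - 1) div 3}} + 2 = num_classes p) \<and>
       (p mod 6 = 5 \<longrightarrow>
          (\<forall>C\<in>mrs_classes p. card C \<noteq> (p - 1) div 2 \<longrightarrow> card C = p - 1) \<and>
          card {C \<in> mrs_classes p. card C \<noteq> (p - 1) div 2} + 1 = num_classes p))"
proof (cases "p = 3")
  case True
  then show ?thesis using num_classes_3 by simp
next
  case False
  interpret prime_gt_3 p
    using assms False by unfold_locales simp_all
  let ?a = "card full_classes" and ?b = "card third_classes"
  have b: "?b = 0 \<or> ?b = 1" using card_third_classes by linarith
  \<comment> \<open>With \<open>y = 1\<close> the constant part 5 + 2 = 7 overflows into one more 6
    and leaves remainder 1; this is why both kinds of classes add 1 to the quotient.\<close>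
  have "n div 6 = x + y \<and> n mod 6 = (if y = 0 then 5 else 1)"
    if "y = 0 \<or> y = 1" "n = 5 + 2 * y + 6 * x" for n x y :: nat
    using that(1)
  proof
    assume "y = 0"
    then show ?thesis unfolding that(2) by simp
  next
    assume y: "y = 1"
    have "n = 1 + 6 * (x + y)" unfolding that(2) y by simp
    then show ?thesis by (simp add: y)
  qed
  from this[OF b p_eq] have div_6: "p div 6 = ?a + ?b" and mod_6: "p mod 6 = (if ?b = 0 then 5 else 1)"
    by blast+
  have num: "num_classes p = p div 6 + 1"
    unfolding num_classes_eq div_6 by simp
  have half_unique: "\<exists>!C. C \<in> mrs_classes p \<and> card C = (p - 1) div 2"
    using half_class(1) card_class_iff(1) by blast
  have mrs_123: "\<forall>C\<in>mrs_classes p. card C = (p - 1) div 2 \<longleftrightarrow> mrs p 1 2 3 \<in> C"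
    using card_class_iff(1) mrs_1_2_3_mem_iff by blast
  have mod_1: "(\<exists>!C. C \<in> mrs_classes p \<and> card C = (p - 1) div 3) \<and>
      (\<forall>C\<in>mrs_classes p. card C \<notin> {(p - 1) div 2, (p - 1) div 3} \<longrightarrow> card C = p - 1) \<and>
      card {C \<in> mrs_classes p. card C \<notin> {(p - 1) div 2, (p - 1) div 3}} + 2 = num_classes p"
    if "p mod 6 = 1"
  proof -
    have "?b \<noteq> 0"
    proof
      assume "?b = 0"
      then show False using mod_6 unfolding that by simp
    qed
    then have b1: "?b = 1" using b by simp
    then obtain D where D: "third_classes = {D}" by (rule card_1_singletonE)
    \<comment> \<open>Makes \<open>(p - 1) div 3\<close> exact, so that it agrees with the size
      condition of \<open>third_classes\<close>.\<close>
    have "3 dvd p - 1" using that by presburger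
    then have third_iff: "card C = (p - 1) div 3 \<longleftrightarrow> C = D" if "C \<in> mrs_classes p" for C
      using card_class_iff(2)[OF that] unfolding D by auto
    have D_in: "D \<in> mrs_classes p" using D mrs_classes_cases by blast
    have rest: "card C \<notin> {(p - 1) div 2, (p - 1) div 3} \<longleftrightarrow> C \<in> full_classes"
      if "C \<in> mrs_classes p" for C
      using that third_iff[OF that] card_class_iff(1)[OF that] mrs_classes_disjoint mrs_classes_cases
      unfolding D by blast
    then have "{C \<in> mrs_classes p. card C \<notin> {(p - 1) div 2, (p - 1) div 3}} = full_classes"
      using mrs_classes_cases by blast
    then show ?thesis
      using third_iff D_in rest card_class_iff(3) num_classes_eq b1 by auto
  qed
  have mod_5: "(\<forall>C\<in>mrs_classes p. card C \<noteq> (p - 1) div 2 \<longrightarrow> card C = p - 1) \<and>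
      card {C \<in> mrs_classes p. card C \<noteq> (p - 1) div 2} + 1 = num_classes p"
    if "p mod 6 = 5"
  proof -
    have b0: "?b = 0"
    proof (rule ccontr)
      assume "?b \<noteq> 0"
      then show False using mod_6 unfolding that by simp
    qed
    then have empty: "third_classes = {}" using finite_classes(1) by simp
    have rest: "card C \<noteq> (p - 1) div 2 \<longleftrightarrow> C \<in> full_classes" if "C \<in> mrs_classes p" for C
      using that card_class_iff(1)[OF that] mrs_classes_disjoint mrs_classes_cases
      unfolding empty by blast
    then have "{C \<in> mrs_classes p. card C \<noteq> (p - 1) div 2} = full_classes"
      using mrs_classes_cases by blast
    then show ?thesis
      using rest card_class_iff(3) num_classes_eq b0 by auto
  qed
  from num half_unique mrs_123 mod_1 mod_5 show ?thesis by blast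
qed

end
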